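(* Let $r\ge0$, $n\ge1$ and $d\ge1$ be integers and write $z=u/(1+u)^2$. Then $$\mathbb{E}(X^{\blacksquare}_{n,r})^{\underline d}=\frac{(2d-2)^{\underline{d-1}}}{C_{n-1}}[z^n]\frac{1-u}{1+u}\,\frac{u^{rd+2d}}{(1-u^{r+2})^{2d}},$$ $$\mathbb{E}X^{\bullet}_{n,r}=\frac1{C_{n-1}}[z^n]\frac{u(1-u^{r+1})(1+u^{r+2})}{(1+u)(1-u^{r+2})^2},$$ and, for $d>1$, $$\mathbb{E}(X^{\bullet}_{n,r})^{\underline d}=\frac1{C_{n-1}}[z^n]\frac{(1-u^{r+1})^d\,u^d\,2^d\,d!}{(1-u)^{d-1}(1+u)(1-u^{r+2})^{2d}}\tilde N_{d-1}(u^{r+2}).$$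
   Context: A plane tree is a finite rooted tree in which the children of every node are linearly ordered (from left to right); its size is its number of nodes. There are $C_{n-1}$ plane trees of size $n$, where $C_m=\frac1{m+1}\binom{2m}{m}$. An old leaf is a leaf (node without children) that is the leftmost child of its parent; the root is never an old leaf. A path is a plane tree in which every node has at most one child (including the single-node tree). For a plane tree $\tau$, $\rho(\tau)$ is the plane tree obtained by cutting all old paths, i.e. by simultaneously deleting every non-root node $v$ such that $v$ is the leftmost child of its parent and the subtree of $\tau$ consisting of $v$ and all its descendants is a path; the single-node tree is mapped to itself. Let $\tau$ be uniformly random among all plane trees of size $n$. $X^{\blacksquare}_{n,r}$ is the number of old leaves of $\rho^r(\tau)$ and $X^{\bullet}_{n,r}$ is the number of nodes of $\rho^r(\tau)$ that are neither old leaves nor parents of old leaves. Associated Narayana polynomials: $\tilde N_m(x)=\sum_{k=1}^m\frac1m\binom{m}{k-1}\binom mk x^k$ for $m\ge1$. The substitution $z=u/(1+u)^2$ means that $u=u(z)$ is the power series in $z$ with $u(0)=0$ satisfying this equation; expressions in $u$ are viewed as power series in $z$ and $[z^n]$ extracts the coefficient of $z^n$. Falling factorial: $x^{\underline d}=x(x-1)\cdots(x-d+1)$, $x^{\underline 0}=1$. *)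

theory Defs
  imports "HOL-Probability.Probability" "HOL-Computational_Algebra.Computational_Algebra"
begin

datatype plane_tree = Node (children: "plane_tree list")

text \<open>
  A node of a tree is addressed by the list of child indices on the way from the root to it;
  the root has address \<open>[]\<close>, and index \<open>0\<close> is the leftmost child.
\<close>

primrec subtree_at :: "nat list \<Rightarrow> plane_tree \<Rightarrow> plane_tree option" where
  "subtree_at [] t = Some t"
| "subtree_at (i # p) t =
     (if i < length (children t) then subtree_at p (children t ! i) else None)"

definition nodes :: "plane_tree \<Rightarrow> nat list set" where
  "nodes t = {v. subtree_at v t \<noteq> None}"

definition plane_trees :: "nat \<Rightarrow> plane_tree set" where
  "plane_trees n = {t. card (nodes t) = n}"

definition old_leaves :: "plane_tree \<Rightarrow> nat list set" where
  "old_leaves t = {v. subtree_at v t = Some (Node []) \<and> (\<exists>u. v = u @ [0])}"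

definition parents_of_old_leaves :: "plane_tree \<Rightarrow> nat list set" where
  "parents_of_old_leaves t = {u. \<exists>i. u @ [i] \<in> old_leaves t}"

definition is_path :: "plane_tree \<Rightarrow> bool" where
  "is_path t \<longleftrightarrow> (\<forall>v s. subtree_at v t = Some s \<longrightarrow> length (children s) \<le> 1)"

text \<open>
  At every surviving node the leftmost child is dropped, together with its subtree, if that
  subtree is a path.  All tests refer to the original tree, so the second child of a node is
  never dropped, even if it becomes the leftmost child.
\<close>

fun cut_old_paths :: "plane_tree \<Rightarrow> plane_tree" where
  "cut_old_paths (Node []) = Node []"
| "cut_old_paths (Node (t # ts)) =
     Node ((if is_path t then [] else [cut_old_paths t]) @ map cut_old_paths ts)"

definition X_square :: "nat \<Rightarrow> plane_tree \<Rightarrow> nat" where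
  "X_square r t = card (old_leaves ((cut_old_paths ^^ r) t))"

definition X_bullet :: "nat \<Rightarrow> plane_tree \<Rightarrow> nat" where
  "X_bullet r t =
     (let t' = (cut_old_paths ^^ r) t
      in card (nodes t' - (old_leaves t' \<union> parents_of_old_leaves t')))"

definition uniform_expectation :: "nat \<Rightarrow> (plane_tree \<Rightarrow> real) \<Rightarrow> real" where
  "uniform_expectation n f = measure_pmf.expectation (pmf_of_set (plane_trees n)) f"

definition catalan :: "nat \<Rightarrow> real" where
  "catalan m = 1 / (real m + 1) * real ((2 * m) choose m)"

definition falling_fact :: "real \<Rightarrow> nat \<Rightarrow> real" where
  "falling_fact x d = (\<Prod>i<d. x - real i)"

definition narayana_assoc :: "nat \<Rightarrow> real poly" where
  "narayana_assoc m =
     (\<Sum>k=1..m. monom (1 / real m * real (m choose (k - 1)) * real (m choose k)) k)"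

lemma ex1_u_series:
  "\<exists>!u :: real fps. fps_nth u 0 = 0 \<and> fps_X = u / (1 + u)\<^sup>2"
proof -
  define f :: "real fps" where "f = fps_X / (1 + fps_X)\<^sup>2"
  have ne: "fps_nth ((1 + v)\<^sup>2) 0 \<noteq> 0" if "fps_nth v 0 = 0" for v :: "real fps"
    using that by (simp add: power2_eq_square)
  have comp: "f oo v = v / (1 + v)\<^sup>2" if "fps_nth v 0 = 0" for v :: "real fps"
  proof -
    have sq: "(1 + fps_X)\<^sup>2 oo v = (1 + v)\<^sup>2"
      using that by (simp add: fps_compose_power[symmetric] fps_compose_add_distrib)
    have "f oo v = (fps_X oo v) / ((1 + fps_X)\<^sup>2 oo v)"
      unfolding f_def
    proof (rule fps_compose_divide_distrib)
      show "(1 + fps_X)\<^sup>2 dvd (fps_X :: real fps)"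
        by (rule unit_imp_dvd) (use ne[of fps_X] in simp)
      show "(1 + fps_X)\<^sup>2 oo v \<noteq> 0"
        using ne[OF that] unfolding sq by (metis fps_zero_nth)
    qed (rule that)
    also have "\<dots> = v / (1 + v)\<^sup>2"
      using that by (simp add: sq)
    finally show ?thesis .
  qed
  have f_inv: "f = fps_X * inverse ((1 + fps_X)\<^sup>2)"
    unfolding f_def using ne[of fps_X] by (simp add: fps_divide_unit)
  have f0: "fps_nth f 0 = 0" and f1: "fps_nth f 1 \<noteq> 0"
    unfolding f_inv by (simp_all add: power2_eq_square)
  show ?thesis
  proof (rule ex1I[of _ "fps_inv f"])
    have "fps_nth (fps_inv f) 0 = 0"
      by (simp add: fps_inv_def)
    with comp[of "fps_inv f"] fps_inv_right[OF f0 f1]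
    show "fps_nth (fps_inv f) 0 = 0 \<and> fps_X = fps_inv f / (1 + fps_inv f)\<^sup>2"
      by simp
  next
    fix v :: "real fps"
    assume v: "fps_nth v 0 = 0 \<and> fps_X = v / (1 + v)\<^sup>2"
    then have "f oo v = fps_X"
      using comp by simp
    then have "fps_inv f = fps_inv f oo (f oo v)"
      by simp
    also have "\<dots> = (fps_inv f oo f) oo v"
      using v f0 by (simp add: fps_compose_assoc)
    also have "\<dots> = v"
      using v fps_inv[OF f0 f1] by simp
    finally show "v = fps_inv f" ..
  qed
qed

definition u_series :: "real fps" where
  "u_series = (THE u. fps_nth u 0 = 0 \<and> fps_X = u / (1 + u)\<^sup>2)"

end

theory Submission
  imports Defs
begin

text \<open>
  Let \<open>z\<close> mark the nodes of a tree that are neither old leaves nor parents of old leaves, and let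
  \<open>w\<close> mark the old leaves.  As every old leaf has its own parent, a tree with \<open>k\<close> old leaves and \<open>j\<close>
  other marked nodes has size \<open>j + 2 * k\<close>.  Splitting a tree at the leftmost child of its root shows
  that the generating function \<open>L(z, w)\<close> of all trees satisfies
  \<open>L - L\<^sup>2 = z + w - z\<^sup>2\<close> (lemma \<open>tree_sum_quadratic\<close>).

  All trees that reduce to a given tree \<open>s\<close> arise from \<open>s\<close> by attaching, independently at every
  node, a possibly empty path as a new leftmost child; only the parent of an old leaf must receive a
  nonempty one, for otherwise that old leaf, together with what was attached to it, would have been
  cut itself.  Hence cutting acts on generating functions as the substitution
  \<open>z \<mapsto> z + a\<close>, \<open>w \<mapsto> a * (z + a)\<close>, where \<open>a = w / (1 - z)\<close> is the contribution of a nonempty path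
  (lemma \<open>cut_fibre_sum\<close>).  Start this substitution from \<open>z\<close> and \<open>z\<^sup>2\<close>, the weights for which a tree
  is counted by its size.  In the variable \<open>u\<close> with \<open>z = u / (1 + u)\<^sup>2\<close> its \<open>r\<close>-th iterate is explicit:
  with \<open>q = u ^ (r + 2)\<close> it is
  \<open>z\<^sub>r = (u - q) / ((1 + u) * (1 - q))\<close> and \<open>w\<^sub>r = q * (1 - u)\<^sup>2 / ((1 + u)\<^sup>2 * (1 - q)\<^sup>2)\<close>
  (lemmas \<open>weight_recursion\<close> and \<open>weight_0\<close>).

  The factorial moments are, up to \<open>fact d\<close> and the number of trees, the coefficients of
  \<open>t ^ d\<close> in \<open>L(z\<^sub>r * (1 + t), w\<^sub>r)\<close> and in \<open>L(z\<^sub>r, w\<^sub>r * (1 + t))\<close>.  Both series solve a quadratic equation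
  whose two roots are distinguished by their constant terms, so it is enough to exhibit a root.
  For old leaves the root is, up to affine rescaling, the Catalan series, for the other
  nodes it is the generating function of the associated Narayana polynomials evaluated at \<open>q\<close>
  (lemmas \<open>square_quadratic\<close> and \<open>bullet_quadratic\<close>).  The closed forms of the Catalan and
  Narayana numbers both enter through one second-order recurrence, which forces the generating
  function to solve a linear differential equation and thereby the quadratic equation
  (lemma \<open>narayana_recurrence_gf\<close>).
\<close>

unbundle no vec_syntax
unbundle fps_syntax

section \<open>Locally finite sums of doubly indexed power series\<close>

text \<open>
  A generating function with a marking variable lives in \<open>'a fps fps\<close>: the outer index is the exponent
  of the marking variable, the inner one the exponent of the size variable.  With this order of the
  two variables the factorial moments are coefficients that are themselves series in the size variable.
  Formal summation over infinitely many combinatorial objects means that every coefficient receives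
  only finitely many contributions.
\<close>

definition has_fsum :: "('i \<Rightarrow> 'a::comm_ring_1 fps fps) \<Rightarrow> 'i set \<Rightarrow> 'a fps fps \<Rightarrow> bool" where
  "has_fsum F I S \<longleftrightarrow> (\<forall>d n. finite {i \<in> I. F i $ d $ n \<noteq> 0} \<and>
      S $ d $ n = (\<Sum>i | i \<in> I \<and> F i $ d $ n \<noteq> 0. F i $ d $ n))"

definition locally_finite :: "('i \<Rightarrow> 'a::comm_ring_1 fps fps) \<Rightarrow> 'i set \<Rightarrow> bool" where
  "locally_finite F I \<longleftrightarrow> (\<forall>d n. finite {i \<in> I. F i $ d $ n \<noteq> 0})"

lemma has_fsum_locally_finite: "has_fsum F I S \<Longrightarrow> locally_finite F I"
  by (simp add: has_fsum_def locally_finite_def)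

lemma locally_finite_has_fsum:
  assumes "locally_finite F I"
  obtains S where "has_fsum F I S"
proof
  show "has_fsum F I (Abs_fps (\<lambda>d. Abs_fps (\<lambda>n. \<Sum>i | i \<in> I \<and> F i $ d $ n \<noteq> 0. F i $ d $ n)))"
    using assms by (simp add: has_fsum_def locally_finite_def)
qed

lemma locally_finite_subset: "locally_finite F I \<Longrightarrow> J \<subseteq> I \<Longrightarrow> locally_finite F J"
  unfolding locally_finite_def
proof (intro allI)
  fix d n
  assume "\<forall>d n. finite {i \<in> I. F i $ d $ n \<noteq> 0}" and "J \<subseteq> I"
  then have "finite {i \<in> I. F i $ d $ n \<noteq> 0}" "{i \<in> J. F i $ d $ n \<noteq> 0} \<subseteq> {i \<in> I. F i $ d $ n \<noteq> 0}"
    by auto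
  then show "finite {i \<in> J. F i $ d $ n \<noteq> 0}"
    by (rule finite_subset[rotated])
qed

lemma has_fsum_unique: "has_fsum F I S \<Longrightarrow> has_fsum F I T \<Longrightarrow> S = T"
  by (simp add: has_fsum_def fps_eq_iff)

lemma has_fsum_cong:
  assumes "\<And>i. i \<in> I \<Longrightarrow> F i = G i"
  shows "has_fsum F I S \<longleftrightarrow> has_fsum G I S"
proof -
  have "{i \<in> I. F i $ d $ n \<noteq> 0} = {i \<in> I. G i $ d $ n \<noteq> 0}" for d n
    using assms by auto
  moreover have "(\<Sum>i | i \<in> I \<and> F i $ d $ n \<noteq> 0. F i $ d $ n) = (\<Sum>i | i \<in> I \<and> G i $ d $ n \<noteq> 0. G i $ d $ n)" for d n
    by (rule sum.cong) (use assms in auto)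
  ultimately show ?thesis
    unfolding has_fsum_def by simp
qed

lemma has_fsum_coeff:
  assumes "has_fsum F I S" "finite J" "J \<subseteq> I" "\<And>i. i \<in> I - J \<Longrightarrow> F i $ d $ n = 0"
  shows "S $ d $ n = (\<Sum>i\<in>J. F i $ d $ n)"
proof -
  have "S $ d $ n = (\<Sum>i | i \<in> I \<and> F i $ d $ n \<noteq> 0. F i $ d $ n)"
    using assms(1) by (simp add: has_fsum_def)
  also have "\<dots> = (\<Sum>i\<in>J. F i $ d $ n)"
    by (rule sum.mono_neutral_left) (use assms in auto)
  finally show ?thesis .
qed

lemma has_fsumI:
  assumes "\<And>d n. \<exists>J. finite J \<and> J \<subseteq> I \<and> (\<forall>i\<in>I - J. F i $ d $ n = 0) \<and> S $ d $ n = (\<Sum>i\<in>J. F i $ d $ n)"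
  shows "has_fsum F I S"
  unfolding has_fsum_def
proof (intro allI conjI)
  fix d n
  from assms[of d n] obtain J where J: "finite J" "J \<subseteq> I" "\<forall>i\<in>I - J. F i $ d $ n = 0"
      "S $ d $ n = (\<Sum>i\<in>J. F i $ d $ n)"
    by (elim exE conjE)
  show "finite {i \<in> I. F i $ d $ n \<noteq> 0}"
    by (rule finite_subset[OF _ J(1)]) (use J(3) in auto)
  show "S $ d $ n = (\<Sum>i | i \<in> I \<and> F i $ d $ n \<noteq> 0. F i $ d $ n)"
    unfolding J(4) by (rule sum.mono_neutral_right) (use J in auto)
qed

lemma has_fsum_empty [simp]: "has_fsum F {} S \<longleftrightarrow> S = 0"
  by (auto simp: has_fsum_def fps_eq_iff)

lemma has_fsum_singleton: "has_fsum F {i} (F i)"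
  by (rule has_fsumI, rule exI[of _ "{i}"]) auto

lemma has_fsum_union:
  assumes S: "has_fsum F I S" and T: "has_fsum F J T" and disj: "I \<inter> J = {}"
  shows "has_fsum F (I \<union> J) (S + T)"
proof (rule has_fsumI)
  fix d n
  let ?A = "{i \<in> I. F i $ d $ n \<noteq> 0}" and ?B = "{i \<in> J. F i $ d $ n \<noteq> 0}"
  have fin: "finite ?A" "finite ?B" using S T by (auto simp: has_fsum_def)
  have "(S + T) $ d $ n = (\<Sum>i\<in>?A. F i $ d $ n) + (\<Sum>i\<in>?B. F i $ d $ n)"
    using S T by (simp add: has_fsum_def)
  also have "\<dots> = (\<Sum>i\<in>?A \<union> ?B. F i $ d $ n)"
    by (rule sum.union_disjoint[symmetric]) (use fin disj in auto)
  finally show "\<exists>K. finite K \<and> K \<subseteq> I \<union> J \<and> (\<forall>i\<in>I \<union> J - K. F i $ d $ n = 0) \<and>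
      (S + T) $ d $ n = (\<Sum>i\<in>K. F i $ d $ n)"
    using fin by (intro exI[of _ "?A \<union> ?B"]) auto
qed

lemma has_fsum_insert:
  assumes "has_fsum F I S" "i \<notin> I"
  shows "has_fsum F (insert i I) (F i + S)"
  using has_fsum_union[OF has_fsum_singleton[of F i] assms(1)] assms(2) by simp

lemma has_fsum_reindex:
  assumes "inj_on f I"
  shows "has_fsum F (f ` I) S \<longleftrightarrow> has_fsum (\<lambda>i. F (f i)) I S"
proof -
  have eq: "{j \<in> f ` I. F j $ d $ n \<noteq> 0} = f ` {i \<in> I. F (f i) $ d $ n \<noteq> 0}" for d n by auto
  have inj: "inj_on f {i \<in> I. F (f i) $ d $ n \<noteq> 0}" for d n
    using assms by (auto intro: inj_on_subset)
  show ?thesis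
    unfolding has_fsum_def eq by (simp add: finite_image_iff[OF inj] sum.reindex[OF inj])
qed

lemma fps_fps_mult_nth_cong:
  fixes S S' T T' :: "'a::comm_ring_1 fps fps"
  assumes "\<And>d' n'. d' \<le> d \<Longrightarrow> n' \<le> n \<Longrightarrow> S $ d' $ n' = S' $ d' $ n'"
    and "\<And>d' n'. d' \<le> d \<Longrightarrow> n' \<le> n \<Longrightarrow> T $ d' $ n' = T' $ d' $ n'"
  shows "(S * T) $ d $ n = (S' * T') $ d $ n"
  using assms by (simp add: fps_mult_nth fps_sum_nth)

text \<open>
  A coefficient of a product depends on finitely many coefficients of the factors, so for each of them
  both sums may be replaced by finite partial sums, to which distributivity applies.
\<close>

lemma has_fsum_times:
  assumes S: "has_fsum F I S" and T: "has_fsum G J T"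
  shows "has_fsum (\<lambda>(i, j). F i * G j) (I \<times> J) (S * T)"
proof (rule has_fsumI)
  fix d n
  define A where "A = (\<Union>d'\<le>d. \<Union>n'\<le>n. {i \<in> I. F i $ d' $ n' \<noteq> 0})"
  define B where "B = (\<Union>d'\<le>d. \<Union>n'\<le>n. {j \<in> J. G j $ d' $ n' \<noteq> 0})"
  have A: "finite A" "A \<subseteq> I" and B: "finite B" "B \<subseteq> J"
    using S T by (auto simp: A_def B_def has_fsum_def)
  have zA: "F i $ d' $ n' = 0" if "i \<in> I - A" "d' \<le> d" "n' \<le> n" for i d' n'
    using that by (auto simp: A_def)
  have zB: "G j $ d' $ n' = 0" if "j \<in> J - B" "d' \<le> d" "n' \<le> n" for j d' n'
    using that by (auto simp: B_def)
  have "(S * T) $ d $ n = ((\<Sum>i\<in>A. F i) * (\<Sum>j\<in>B. G j)) $ d $ n"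
  proof (rule fps_fps_mult_nth_cong)
    fix d' n' assume le: "d' \<le> d" "n' \<le> n"
    show "S $ d' $ n' = (\<Sum>i\<in>A. F i) $ d' $ n'"
      using has_fsum_coeff[OF S A] zA le by (simp add: fps_sum_nth)
    show "T $ d' $ n' = (\<Sum>j\<in>B. G j) $ d' $ n'"
      using has_fsum_coeff[OF T B] zB le by (simp add: fps_sum_nth)
  qed
  also have "\<dots> = (\<Sum>p\<in>A \<times> B. (case p of (i, j) \<Rightarrow> F i * G j) $ d $ n)"
    by (simp add: sum_product sum.cartesian_product fps_sum_nth case_prod_unfold)
  finally have eq: "(S * T) $ d $ n = (\<Sum>p\<in>A \<times> B. (case p of (i, j) \<Rightarrow> F i * G j) $ d $ n)" .
  have "(F i * G j) $ d $ n = 0" if "i \<in> I" "j \<in> J" "(i, j) \<notin> A \<times> B" for i j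
    using that fps_fps_mult_nth_cong[of d n "F i" 0 "G j" "G j"]
      fps_fps_mult_nth_cong[of d n "F i" "F i" "G j" 0] zA zB by auto
  then show "\<exists>K. finite K \<and> K \<subseteq> I \<times> J \<and> (\<forall>p\<in>I \<times> J - K. (case p of (i, j) \<Rightarrow> F i * G j) $ d $ n = 0) \<and>
      (S * T) $ d $ n = (\<Sum>p\<in>K. (case p of (i, j) \<Rightarrow> F i * G j) $ d $ n)"
    using A B eq by (intro exI[of _ "A \<times> B"]) auto
qed

lemma has_fsum_cmult:
  assumes "has_fsum F I S"
  shows "has_fsum (\<lambda>i. c * F i) I (c * S)"
proof -
  have "has_fsum (\<lambda>(j, i). (\<lambda>_. c) j * F i) ({()} \<times> I) (c * S)"
    by (rule has_fsum_times[OF has_fsum_singleton assms])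
  moreover have "{()} \<times> I = Pair () ` I" by auto
  ultimately show ?thesis by (simp add: has_fsum_reindex inj_on_def)
qed

text \<open>
  Rearrangement of a sum along a map; it is the tool that replaces a sum over all trees by a sum over
  their reductions.
\<close>

lemma has_fsum_fibres:
  assumes S: "has_fsum F I S" and G: "\<And>j. has_fsum F {i \<in> I. p i = j} (G j)"
  shows "has_fsum G UNIV S"
proof (rule has_fsumI)
  fix d n
  define K where "K = {i \<in> I. F i $ d $ n \<noteq> 0}"
  have K: "finite K" "S $ d $ n = (\<Sum>i\<in>K. F i $ d $ n)"
    using S by (auto simp: has_fsum_def K_def)
  have Gn: "G j $ d $ n = (\<Sum>i\<in>{i \<in> K. p i = j}. F i $ d $ n)" for j
  proof (rule has_fsum_coeff[OF G])
    show "finite {i \<in> K. p i = j}" using K(1) by simp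
  qed (auto simp: K_def)
  have "G j $ d $ n = 0" if "j \<notin> p ` K" for j
    unfolding Gn using that by (intro sum.neutral) auto
  moreover have "S $ d $ n = (\<Sum>j\<in>p ` K. G j $ d $ n)"
    unfolding K(2) Gn using K(1) by (simp add: sum.group)
  ultimately show "\<exists>J. finite J \<and> J \<subseteq> UNIV \<and> (\<forall>j\<in>UNIV - J. G j $ d $ n = 0) \<and>
      S $ d $ n = (\<Sum>j\<in>J. G j $ d $ n)"
    using K(1) by (intro exI[of _ "p ` K"]) auto
qed

text \<open>
  Divisibility by a power of the size variable serves as the multiplicative bound on orders that
  makes sums over trees locally finite.
\<close>

lemma dvd_const_X_power_nth:
  assumes "fps_const fps_X ^ k dvd F" "n < k"
  shows "F $ d $ n = 0"
  using assms by (auto simp: dvd_def fps_X_power_mult_nth)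

section \<open>Counting nodes and old leaves recursively\<close>

text \<open>
  The ordinary nodes are those that are neither old leaves nor parents of old leaves.  If the leftmost
  child of the root is a leaf, this child and the root form a pair and neither is ordinary; otherwise
  the root is ordinary.
\<close>

fun ordinary_count :: "plane_tree \<Rightarrow> nat" where
  "ordinary_count (Node []) = 1"
| "ordinary_count (Node (c # cs)) = (if c = Node [] then 0 else 1 + ordinary_count c) + sum_list (map ordinary_count cs)"

fun old_count :: "plane_tree \<Rightarrow> nat" where
  "old_count (Node []) = 0"
| "old_count (Node (c # cs)) = (if c = Node [] then 1 else old_count c) + sum_list (map old_count cs)"

primrec tree_size :: "plane_tree \<Rightarrow> nat" where
  "tree_size (Node ts) = Suc (sum_list (map tree_size ts))"

lemma nodes_Node: "nodes (Node ts) = insert [] (\<Union>i<length ts. (#) i ` nodes (ts ! i))"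
proof (rule set_eqI)
  fix v show "v \<in> nodes (Node ts) \<longleftrightarrow> v \<in> insert [] (\<Union>i<length ts. (#) i ` nodes (ts ! i))"
    by (cases v) (auto simp: nodes_def)
qed

lemma card_UN_Cons:
  fixes k :: nat
  assumes "\<And>i. i < k \<Longrightarrow> finite (B i)"
  shows "card (\<Union>i<k. (#) i ` B i) = (\<Sum>i<k. card (B i))"
  using assms by (subst card_UN_disjoint) (auto simp: card_image inj_on_def)

lemma nodes_finite_card: "finite (nodes t) \<and> card (nodes t) = tree_size t"
proof (induction t)
  case (Node ts)
  then have IH: "i < length ts \<Longrightarrow> finite (nodes (ts ! i))" "i < length ts \<Longrightarrow> card (nodes (ts ! i)) = tree_size (ts ! i)" for i
    by auto
  have "card (nodes (Node ts)) = Suc (\<Sum>i<length ts. card (nodes (ts ! i)))"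
    unfolding nodes_Node by (subst card_insert_disjoint) (use IH in \<open>auto simp: card_UN_Cons\<close>)
  also have "\<dots> = tree_size (Node ts)"
    using IH by (simp add: sum_list_sum_nth atLeast0LessThan)
  finally show ?case using IH by (auto simp: nodes_Node)
qed

lemma old_leaves_Node:
  "old_leaves (Node ts) =
     (if ts \<noteq> [] \<and> hd ts = Node [] then {[0]} else {}) \<union> (\<Union>i<length ts. (#) i ` old_leaves (ts ! i))"
proof (rule set_eqI)
  fix v show "v \<in> old_leaves (Node ts) \<longleftrightarrow> v \<in> (if ts \<noteq> [] \<and> hd ts = Node [] then {[0]} else {}) \<union>
      (\<Union>i<length ts. (#) i ` old_leaves (ts ! i))"
  proof (cases v)
    case Nil then show ?thesis by (auto simp: old_leaves_def)
  next
    case (Cons i w)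
    show ?thesis
    proof (cases w rule: rev_cases)
      case Nil
      then show ?thesis using Cons by (cases ts) (auto simp: old_leaves_def hd_conv_nth)
    next
      case (snoc w' j)
      then show ?thesis using Cons by (auto simp: old_leaves_def)
    qed
  qed
qed

lemma old_leaves_subset_nodes: "old_leaves t \<subseteq> nodes t"
  by (auto simp: old_leaves_def nodes_def)

lemma finite_old_leaves: "finite (old_leaves t)"
  using finite_subset[OF old_leaves_subset_nodes] nodes_finite_card by blast

lemma old_leaves_leaf [simp]: "old_leaves (Node []) = {}"
  by (auto simp: old_leaves_Node)

lemma card_old_leaves: "card (old_leaves t) = old_count t"
proof (induction t rule: old_count.induct)
  case (2 c cs)
  let ?U = "\<Union>i<length (c # cs). (#) i ` old_leaves ((c # cs) ! i)"
  have "finite ?U" "[0] \<notin> ?U"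
    by (auto simp: finite_old_leaves, auto simp: old_leaves_def)
  then have "card (old_leaves (Node (c # cs))) = (if c = Node [] then 1 else 0) + card ?U"
    unfolding old_leaves_Node by (cases "c = Node []") simp_all
  also have "card ?U =
      (\<Sum>i<length (c # cs). card (old_leaves ((c # cs) ! i)))"
    by (rule card_UN_Cons) (simp add: finite_old_leaves)
  also have "\<dots> = sum_list (map (\<lambda>s. card (old_leaves s)) (c # cs))"
    by (simp only: sum_list_sum_nth length_map atLeast0LessThan)
       (rule sum.cong, simp_all only: lessThan_iff nth_map)
  also have "\<dots> = card (old_leaves c) + sum_list (map old_count cs)"
    using 2 by (simp cong: map_cong)
  finally show ?case using 2 by auto
qed auto

lemma tree_size_count: "tree_size t = ordinary_count t + 2 * old_count t"
proof (induction t rule: old_count.induct)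
  case (2 c cs)
  have "sum_list (map tree_size cs) = sum_list (map ordinary_count cs) + 2 * sum_list (map old_count cs)"
    using 2(2) by (induction cs) auto
  then show ?case using 2(1) by auto
qed auto

text \<open>
  An old leaf determines its parent by dropping the final \<open>0\<close> of its address, and conversely; since an
  old leaf has no child, it is not the parent of another one.  Thus old leaves and their parents
  together are twice as many as the old leaves.
\<close>

lemma card_bullets: "card (nodes t - (old_leaves t \<union> parents_of_old_leaves t)) = ordinary_count t"
proof -
  have old: "v \<in> old_leaves t \<Longrightarrow> v = butlast v @ [0]" for v
    by (auto simp: old_leaves_def)
  have par: "parents_of_old_leaves t = butlast ` old_leaves t"
  proof (rule set_eqI)
    fix u
    have "u \<in> butlast ` old_leaves t" if "u @ [i] \<in> old_leaves t" for i
      using imageI[OF that, of butlast] by simp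
    moreover have "butlast v @ [0] \<in> old_leaves t" if "v \<in> old_leaves t" for v
      using old[OF that] that by simp
    ultimately show "u \<in> parents_of_old_leaves t \<longleftrightarrow> u \<in> butlast ` old_leaves t"
      unfolding parents_of_old_leaves_def by blast
  qed
  have inj: "inj_on butlast (old_leaves t)"
    using old by (metis inj_onI)
  have sub: "subtree_at (u @ v) t = (case subtree_at u t of None \<Rightarrow> None | Some s \<Rightarrow> subtree_at v s)" for u v t
    by (induction u arbitrary: t) auto
  have parent: "subtree_at u t \<noteq> None \<and> subtree_at u t \<noteq> Some (Node [])" if "u @ [i] \<in> old_leaves t" for u i
    using that by (auto simp: old_leaves_def sub split: option.splits)
  have disj: "old_leaves t \<inter> parents_of_old_leaves t = {}"
    using parent by (auto simp: parents_of_old_leaves_def) (auto simp: old_leaves_def)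
  have "parents_of_old_leaves t \<subseteq> nodes t"
    using parent by (auto simp: parents_of_old_leaves_def nodes_def)
  then have "card (nodes t - (old_leaves t \<union> parents_of_old_leaves t)) =
      card (nodes t) - card (old_leaves t \<union> parents_of_old_leaves t)"
    using old_leaves_subset_nodes[of t] nodes_finite_card[of t]
    by (intro card_Diff_subset) (auto intro: finite_subset)
  also have "card (old_leaves t \<union> parents_of_old_leaves t) = 2 * old_count t"
    using disj by (subst card_Un_disjoint) (auto simp: finite_old_leaves par card_image[OF inj] card_old_leaves)
  finally show ?thesis using nodes_finite_card[of t] tree_size_count[of t] by simp
qed

lemma finite_trees_of_size_le: "finite {t. tree_size t \<le> n}"
proof (induction n)
  case 0
  have "\<not> tree_size t \<le> 0" for t by (cases t) simp
  then have "{t. tree_size t \<le> 0} = {}" by blast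
  then show ?case by (simp only: finite.emptyI)
next
  case (Suc n)
  have pos: "tree_size t \<ge> 1" for t by (cases t) auto
  have "{t. tree_size t \<le> Suc n} \<subseteq> Node ` {ts. set ts \<subseteq> {t. tree_size t \<le> n} \<and> length ts \<le> n}"
  proof
    fix t assume t: "t \<in> {t. tree_size t \<le> Suc n}"
    obtain ts where ts: "t = Node ts" by (cases t)
    have le: "sum_list (map tree_size ts) \<le> n" using t ts by simp
    have "length ts \<le> sum_list (map tree_size ts)"
    proof (induction ts)
      case (Cons a ts)
      then show ?case using pos[of a] by simp
    qed simp
    moreover have "tree_size s \<le> n" if "s \<in> set ts" for s
      using member_le_sum_list[of "tree_size s" "map tree_size ts"] that le by auto
    ultimately show "t \<in> Node ` {ts. set ts \<subseteq> {t. tree_size t \<le> n} \<and> length ts \<le> n}"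
      using ts le by auto
  qed
  moreover have "finite (Node ` {ts. set ts \<subseteq> {t. tree_size t \<le> n} \<and> length ts \<le> n})"
    by (intro finite_imageI finite_lists_length_le Suc)
  ultimately show ?case by (rule finite_subset)
qed

lemma is_path_leaf [simp]: "is_path (Node [])"
  unfolding is_path_def
proof (intro allI impI)
  fix v s show "subtree_at v (Node []) = Some s \<Longrightarrow> length (children s) \<le> 1" by (cases v) auto
qed

lemma is_path_Cons [simp]: "is_path (Node (c # cs)) \<longleftrightarrow> cs = [] \<and> is_path c"
proof
  assume p: "is_path (Node (c # cs))"
  then have "length (children (Node (c # cs))) \<le> 1"
    unfolding is_path_def by (metis subtree_at.simps(1))
  moreover have "is_path c"
    unfolding is_path_def
  proof (intro allI impI)
    fix v s assume "subtree_at v c = Some s"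
    then have "subtree_at (0 # v) (Node (c # cs)) = Some s" by simp
    then show "length (children s) \<le> 1" using p unfolding is_path_def by blast
  qed
  ultimately show "cs = [] \<and> is_path c" by simp
next
  assume a: "cs = [] \<and> is_path c"
  show "is_path (Node (c # cs))"
    unfolding is_path_def
  proof (intro allI impI)
    fix v s assume "subtree_at v (Node (c # cs)) = Some s"
    then show "length (children s) \<le> 1"
      using a by (cases v) (auto simp: is_path_def split: if_splits)
  qed
qed

text \<open>
  This singles out the preimages of the single node, and it is why a leftmost child that becomes a leaf
  cannot have survived the cutting.
\<close>

lemma cut_old_paths_eq_leaf_iff: "cut_old_paths t = Node [] \<longleftrightarrow> is_path t"
  by (induction t rule: cut_old_paths.induct) auto

section \<open>Generating functions of trees and the effect of cutting\<close>

definition tree_weight :: "'a::comm_ring_1 \<Rightarrow> 'a \<Rightarrow> plane_tree \<Rightarrow> 'a" where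
  "tree_weight z w t = z ^ ordinary_count t * w ^ old_count t"

definition forest_weight :: "'a::comm_ring_1 \<Rightarrow> 'a \<Rightarrow> plane_tree list \<Rightarrow> 'a" where
  "forest_weight z w ts = prod_list (map (tree_weight z w) ts)"

text \<open>
  The joint contribution of the root and of the subtree at its leftmost child \<open>c\<close>.  It makes the weight
  of a tree multiplicative along the children of the root although the old leaf statistic is not.
\<close>

definition root_weight :: "'a::comm_ring_1 \<Rightarrow> 'a \<Rightarrow> plane_tree \<Rightarrow> 'a" where
  "root_weight z w c = (if c = Node [] then w else z * tree_weight z w c)"

lemma forest_weight_simps [simp]:
  "forest_weight z w [] = 1"
  "forest_weight z w (t # ts) = tree_weight z w t * forest_weight z w ts"
  by (simp_all add: forest_weight_def)

lemma forest_weight_counts: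
  "forest_weight z w ts = z ^ sum_list (map ordinary_count ts) * w ^ sum_list (map old_count ts)"
  by (induction ts) (simp_all add: tree_weight_def power_add algebra_simps)

lemma tree_weight_leaf [simp]: "tree_weight z w (Node []) = z"
  by (simp add: tree_weight_def)

lemma tree_weight_Cons [simp]:
  "tree_weight z w (Node (c # cs)) = root_weight z w c * forest_weight z w cs"
  by (simp add: forest_weight_counts tree_weight_def root_weight_def power_add algebra_simps)

lemma weight_nth_eq_0:
  assumes "fps_const fps_X dvd z" "fps_const fps_X dvd w" "n < i + j"
  shows "(z ^ i * w ^ j * h) $ d $ n = 0"
proof (rule dvd_const_X_power_nth[OF _ assms(3)])
  show "fps_const fps_X ^ (i + j) dvd z ^ i * w ^ j * h"
    unfolding power_add by (intro dvd_mult2 mult_dvd_mono dvd_power_same assms)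
qed

lemma locally_finite_tree_weight:
  assumes "fps_const fps_X dvd z" "fps_const fps_X dvd w"
  shows "locally_finite (\<lambda>t. tree_weight z w t * h t) I"
  unfolding locally_finite_def
proof (intro allI)
  fix d n
  have "{t \<in> I. (tree_weight z w t * h t) $ d $ n \<noteq> 0} \<subseteq> {t. tree_size t \<le> 2 * n}"
  proof
    fix t assume "t \<in> {t \<in> I. (tree_weight z w t * h t) $ d $ n \<noteq> 0}"
    then have "\<not> n < ordinary_count t + old_count t"
      using weight_nth_eq_0[OF assms] unfolding tree_weight_def by blast
    then show "t \<in> {t. tree_size t \<le> 2 * n}"
      by (simp add: tree_size_count)
  qed
  then show "finite {t \<in> I. (tree_weight z w t * h t) $ d $ n \<noteq> 0}"
    using finite_trees_of_size_le by (rule finite_subset)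
qed

lemma locally_finite_forest_weight:
  assumes "fps_const fps_X dvd z" "fps_const fps_X dvd w"
  shows "locally_finite (forest_weight z w) I"
  unfolding locally_finite_def
proof (intro allI)
  fix d n
  have "{ts \<in> I. forest_weight z w ts $ d $ n \<noteq> 0} \<subseteq> Node -` {t. tree_size t \<le> 2 * n + 1}"
  proof
    fix ts assume "ts \<in> {ts \<in> I. forest_weight z w ts $ d $ n \<noteq> 0}"
    then have "\<not> n < sum_list (map ordinary_count ts) + sum_list (map old_count ts)"
      using weight_nth_eq_0[OF assms, where h = 1] unfolding forest_weight_counts by auto
    moreover have "sum_list (map tree_size ts) = sum_list (map ordinary_count ts) + 2 * sum_list (map old_count ts)"
      by (induction ts) (simp_all add: tree_size_count)
    ultimately show "ts \<in> Node -` {t. tree_size t \<le> 2 * n + 1}" by simp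
  qed
  moreover have "finite (Node -` {t. tree_size t \<le> 2 * n + 1})"
    by (rule finite_vimageI[OF finite_trees_of_size_le]) (simp add: inj_def)
  ultimately show "finite {ts \<in> I. forest_weight z w ts $ d $ n \<noteq> 0}"
    by (rule finite_subset)
qed

lemma insert_Compl_self: "insert x (- {x}) = UNIV"
  by auto

lemma has_fsum_Cons:
  assumes "has_fsum (tree_weight z w) A S" "has_fsum (forest_weight z w) B T"
  shows "has_fsum (forest_weight z w) ((\<lambda>(c, cs). c # cs) ` (A \<times> B)) (S * T)"
proof -
  have "inj_on (\<lambda>(c, cs). c # cs) (A \<times> B)" by (auto simp: inj_on_def)
  moreover have "(\<lambda>p. forest_weight z w (case p of (c, cs) \<Rightarrow> c # cs)) =
      (\<lambda>(c, cs). tree_weight z w c * forest_weight z w cs)"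
    by (simp add: fun_eq_iff)
  ultimately show ?thesis
    using has_fsum_times[OF assms] by (simp add: has_fsum_reindex)
qed

lemma has_fsum_Node_Cons:
  assumes "has_fsum (root_weight z w) A S" "has_fsum (forest_weight z w) B T"
  shows "has_fsum (tree_weight z w) ((\<lambda>(c, cs). Node (c # cs)) ` (A \<times> B)) (S * T)"
proof -
  have "inj_on (\<lambda>(c, cs). Node (c # cs)) (A \<times> B)" by (auto simp: inj_on_def)
  moreover have "(\<lambda>p. tree_weight z w (case p of (c, cs) \<Rightarrow> Node (c # cs))) =
      (\<lambda>(c, cs). root_weight z w c * forest_weight z w cs)"
    by (simp add: fun_eq_iff)
  ultimately show ?thesis
    using has_fsum_times[OF assms] by (simp add: has_fsum_reindex)
qed

lemma has_fsum_root_weight_nonleaf: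
  assumes "has_fsum (tree_weight z w) I S" "Node [] \<notin> I"
  shows "has_fsum (root_weight z w) I (z * S)"
proof -
  have "root_weight z w c = z * tree_weight z w c" if "c \<in> I" for c
    using that assms(2) by (auto simp: root_weight_def)
  then show ?thesis
    using has_fsum_cmult[OF assms(1), of z] by (subst has_fsum_cong[where G = "\<lambda>c. z * tree_weight z w c"]) auto
qed

text \<open>
  Write \<open>\<Lambda>\<close> for the generating function of lists of trees and \<open>M\<close> for that of the trees with more than
  one node.  Then \<open>\<Lambda> = 1 + L * \<Lambda>\<close>, \<open>L = z + M\<close>, and the decomposition of a tree into the leftmost subtree
  and the list of the remaining ones gives \<open>M = (w + z * M) * \<Lambda>\<close>.  Eliminating \<open>\<Lambda>\<close> and \<open>M\<close> yields the
  equation.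
\<close>

lemma tree_sum_quadratic:
  assumes "fps_const fps_X dvd z" "fps_const fps_X dvd w"
    and L: "has_fsum (tree_weight z w) UNIV L"
  shows "L - L\<^sup>2 = z + w - z\<^sup>2"
proof -
  obtain \<Lambda> where \<Lambda>: "has_fsum (forest_weight z w) UNIV \<Lambda>"
    using locally_finite_forest_weight[OF assms(1,2)] by (rule locally_finite_has_fsum)
  obtain M where M: "has_fsum (tree_weight z w) (- {Node []}) M"
    using locally_finite_subset[OF has_fsum_locally_finite[OF L], of "- {Node []}"]
    by (auto elim: locally_finite_has_fsum)
  have LM: "L = z + M"
    using has_fsum_insert[OF M, of "Node []"] has_fsum_unique[OF L] by (simp add: insert_Compl_self)
  have R: "has_fsum (root_weight z w) UNIV (w + z * M)"
    using has_fsum_insert[OF has_fsum_root_weight_nonleaf[OF M], of "Node []"]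
    by (simp add: root_weight_def insert_Compl_self)
  have "ts \<in> insert [] ((\<lambda>(c::plane_tree, cs). c # cs) ` (UNIV \<times> UNIV))" for ts
    by (cases ts) auto
  then have "insert [] ((\<lambda>(c::plane_tree, cs). c # cs) ` (UNIV \<times> UNIV)) = UNIV" by blast
  then have "has_fsum (forest_weight z w) UNIV (1 + L * \<Lambda>)"
    using has_fsum_insert[OF has_fsum_Cons[OF L \<Lambda>], of "[]"]
    by (simp add: image_iff split_beta)
  then have \<Lambda>L: "\<Lambda> = 1 + L * \<Lambda>" by (rule has_fsum_unique[OF \<Lambda>])
  have "t \<in> (\<lambda>(c, cs). Node (c # cs)) ` (UNIV \<times> UNIV)" if "t \<noteq> Node []" for t
    using that by (cases t rule: cut_old_paths.cases) auto
  then have "- {Node []} = (\<lambda>(c, cs). Node (c # cs)) ` (UNIV \<times> UNIV)" by auto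
  then have "has_fsum (tree_weight z w) (- {Node []}) ((w + z * M) * \<Lambda>)"
    using has_fsum_Node_Cons[OF R \<Lambda>] by (simp only:)
  then have MR: "M = (w + z * M) * \<Lambda>" by (rule has_fsum_unique[OF M])
  have "M * (1 - L) = (w + z * M) * (\<Lambda> - L * \<Lambda>)"
    by (subst (1) MR) (simp add: algebra_simps)
  also have "\<Lambda> - L * \<Lambda> = 1" using \<Lambda>L by (simp add: algebra_simps)
  finally have M_eq: "M * (1 - (z + M)) = w + z * M" unfolding LM by simp
  have "L - L\<^sup>2 = z - z\<^sup>2 + M * (1 - (z + M)) - z * M"
    unfolding LM by (simp add: algebra_simps power2_eq_square)
  then show ?thesis unfolding M_eq by simp
qed

lemma const_X_dvd_nth_0: "fps_const fps_X dvd F \<Longrightarrow> F $ d $ 0 = 0"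
  using dvd_const_X_power_nth[of 1 F 0 d] by simp

text \<open>
  A path that is attached as leftmost child contributes \<open>w\<close> for its last node and the parent of that
  node, and \<open>z\<close> for every other node.  So the sum \<open>a\<close> over all paths satisfies \<open>a = w + z * a\<close>, which
  has a unique solution.
\<close>

lemma path_sum:
  fixes z w a :: "'a::idom fps fps"
  assumes "fps_const fps_X dvd z" "fps_const fps_X dvd w" "w = a * (1 - z)"
  shows "has_fsum (root_weight z w) {c. is_path c} a"
proof -
  have "locally_finite (tree_weight z w) (- {Node []})"
    using locally_finite_tree_weight[OF assms(1,2), of "\<lambda>_. 1"] by simp
  then obtain M where M: "has_fsum (tree_weight z w) (- {Node []}) M"
    by (rule locally_finite_has_fsum)
  have "locally_finite (root_weight z w) UNIV"
    using has_fsum_insert[OF has_fsum_root_weight_nonleaf[OF M], of "Node []"]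
    by (auto simp: insert_Compl_self intro: has_fsum_locally_finite)
  then obtain S where S: "has_fsum (root_weight z w) {c. is_path c} S"
    using locally_finite_subset[of _ UNIV "{c. is_path c}"] by (auto elim: locally_finite_has_fsum)
  have "has_fsum (root_weight z w) ((\<lambda>c. Node [c]) ` {c. is_path c}) (z * S)"
    by (subst has_fsum_reindex) (use has_fsum_cmult[OF S, of z] in \<open>simp_all add: inj_on_def root_weight_def[of z w "Node [_]"]\<close>)
  then have "has_fsum (root_weight z w) (insert (Node []) ((\<lambda>c. Node [c]) ` {c. is_path c})) (w + z * S)"
    using has_fsum_insert[of "root_weight z w" _ "z * S" "Node []"] by (auto simp: root_weight_def)
  moreover have "insert (Node []) ((\<lambda>c. Node [c]) ` {c. is_path c}) = {c. is_path c}"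
  proof (rule set_eqI)
    fix t show "t \<in> insert (Node []) ((\<lambda>c. Node [c]) ` {c. is_path c}) \<longleftrightarrow> t \<in> {c. is_path c}"
      by (cases t rule: cut_old_paths.cases) auto
  qed
  ultimately have "has_fsum (root_weight z w) {c. is_path c} (w + z * S)" by (simp only:)
  then have S_eq: "S = w + z * S" by (rule has_fsum_unique[OF S])
  have "(S - a) * (1 - z) = S - (a * (1 - z) + z * S)" by (simp add: algebra_simps)
  also have "\<dots> = 0" unfolding assms(3)[symmetric] S_eq[symmetric] by simp
  finally have "(S - a) * (1 - z) = 0" .
  moreover have "1 - z \<noteq> 0"
  proof
    assume "1 - z = 0"
    then have "(1 - z) $ 0 $ 0 = 0" by simp
    then show False using const_X_dvd_nth_0[OF assms(1)] by simp
  qed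
  ultimately show ?thesis using S by simp
qed

text \<open>
  Induction on the reduced tree.  In a preimage of \<open>Node ss\<close> the root either carries an attached path
  in front of preimages of \<open>ss\<close>, which contributes the factor \<open>a\<close>, or its children are exactly preimages
  of \<open>ss\<close>.  In the latter case the leftmost child must not be a path, hence must not reduce to a leaf,
  and the root keeps its weight \<open>z\<close>.  A root together with an old leaf below it thus gets
  \<open>a * (z + a)\<close>: the root needs a path, the old leaf may have one.
\<close>

lemma cut_fibre_sum:
  fixes z w a :: "'a::idom fps fps"
  assumes "fps_const fps_X dvd z" "fps_const fps_X dvd w" "w = a * (1 - z)"
  shows "has_fsum (tree_weight z w) {t. cut_old_paths t = s} (tree_weight (z + a) (a * (z + a)) s)"
proof (induction s)
  case (Node ss)
  define z' w' where "z' = z + a" and "w' = a * z'"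
  have IH: "has_fsum (tree_weight z w) {t. cut_old_paths t = u} (tree_weight z' w' u)" if "u \<in> set ss" for u
    using Node that by (simp add: z'_def w'_def)
  have forest: "has_fsum (forest_weight z w) {ts. map cut_old_paths ts = us} (forest_weight z' w' us)"
    if "set us \<subseteq> set ss" for us
    using that
  proof (induction us)
    case Nil
    show ?case using has_fsum_singleton[of "forest_weight z w" "[]"] by simp
  next
    case (Cons u us)
    have "{ts. map cut_old_paths ts = u # us} =
        (\<lambda>(c, cs). c # cs) ` ({c. cut_old_paths c = u} \<times> {cs. map cut_old_paths cs = us})"
      by (auto simp: map_eq_Cons_conv)
    then show ?case using has_fsum_Cons[OF IH[of u] Cons.IH] Cons.prems by simp
  qed
  \<comment> \<open>The preimages whose root carries an attached path.\<close>
  define P where "P = (\<lambda>(c, cs). Node (c # cs)) ` ({c. is_path c} \<times> {cs. map cut_old_paths cs = ss})"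
  have P: "has_fsum (tree_weight z w) P (a * forest_weight z' w' ss)"
    unfolding P_def by (rule has_fsum_Node_Cons[OF path_sum[OF assms] forest]) simp
  show ?case
  proof (cases ss)
    case Nil
    have "{t. cut_old_paths t = Node ss} = insert (Node []) P"
    proof (rule set_eqI)
      fix t show "t \<in> {t. cut_old_paths t = Node ss} \<longleftrightarrow> t \<in> insert (Node []) P"
        by (cases t rule: cut_old_paths.cases) (auto simp: P_def Nil)
    qed
    moreover have "Node [] \<notin> P" by (auto simp: P_def)
    ultimately show ?thesis
      using has_fsum_insert[OF P, of "Node []"] by (simp add: Nil)
  next
    case (Cons u us)
    \<comment> \<open>The preimages whose root carries no attached path.\<close>
    define N where "N = (\<lambda>(c, cs). Node (c # cs)) ` ({c. \<not> is_path c \<and> cut_old_paths c = u} \<times> {cs. map cut_old_paths cs = us})"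
    have "has_fsum (root_weight z w) {c. \<not> is_path c \<and> cut_old_paths c = u}
        (if u = Node [] then 0 else z * tree_weight z' w' u)"
    proof (cases "u = Node []")
      case True
      then have "{c. \<not> is_path c \<and> cut_old_paths c = u} = {}"
        by (auto simp: cut_old_paths_eq_leaf_iff)
      then show ?thesis using True by (simp only: has_fsum_empty) simp
    next
      case False
      then have "{c. \<not> is_path c \<and> cut_old_paths c = u} = {c. cut_old_paths c = u}"
        by (auto simp flip: cut_old_paths_eq_leaf_iff)
      then show ?thesis
        using False has_fsum_root_weight_nonleaf[OF IH[of u]] by (simp add: Cons)
    qed
    then have N: "has_fsum (tree_weight z w) N
        ((if u = Node [] then 0 else z * tree_weight z' w' u) * forest_weight z' w' us)"
      unfolding N_def by (rule has_fsum_Node_Cons[OF _ forest]) (auto simp: Cons)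
    have "{t. cut_old_paths t = Node ss} = P \<union> N"
    proof (rule set_eqI)
      fix t show "t \<in> {t. cut_old_paths t = Node ss} \<longleftrightarrow> t \<in> P \<union> N"
        by (cases t rule: cut_old_paths.cases) (auto simp: P_def N_def Cons)
    qed
    moreover have "P \<inter> N = {}" by (auto simp: P_def N_def)
    moreover have "a * forest_weight z' w' ss +
        (if u = Node [] then 0 else z * tree_weight z' w' u) * forest_weight z' w' us =
        tree_weight z' w' (Node ss)"
      by (simp add: Cons root_weight_def w'_def z'_def algebra_simps)
    ultimately show ?thesis
      using has_fsum_union[OF P N] by (simp add: z'_def w'_def)
  qed
qed

lemma has_fsum_cut:
  fixes z w a :: "'a::idom fps fps"
  assumes "fps_const fps_X dvd z" "fps_const fps_X dvd w" "w = a * (1 - z)"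
    and S: "has_fsum (\<lambda>t. tree_weight z w t * h (cut_old_paths t)) UNIV S"
  shows "has_fsum (\<lambda>s. tree_weight (z + a) (a * (z + a)) s * h s) UNIV S"
proof (rule has_fsum_fibres[OF S, where p = cut_old_paths])
  fix s
  have "has_fsum (\<lambda>t. h s * tree_weight z w t) {t. cut_old_paths t = s} (h s * tree_weight (z + a) (a * (z + a)) s)"
    by (rule has_fsum_cmult[OF cut_fibre_sum[OF assms(1-3)]])
  then show "has_fsum (\<lambda>t. tree_weight z w t * h (cut_old_paths t)) {t \<in> UNIV. cut_old_paths t = s}
      (tree_weight (z + a) (a * (z + a)) s * h s)"
    by (subst has_fsum_cong[where G = "\<lambda>t. h s * tree_weight z w t"]) (simp_all add: mult.commute)
qed

lemma has_fsum_iterated_cut: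
  fixes z w a :: "nat \<Rightarrow> 'a::idom fps fps"
  assumes "\<And>i. fps_const fps_X dvd z i" "\<And>i. fps_const fps_X dvd w i" "\<And>i. w i = a i * (1 - z i)"
    and "\<And>i. z (Suc i) = z i + a i" "\<And>i. w (Suc i) = a i * z (Suc i)"
    and "has_fsum (\<lambda>t. tree_weight (z 0) (w 0) t * h ((cut_old_paths ^^ r) t)) UNIV S"
  shows "has_fsum (\<lambda>s. tree_weight (z r) (w r) s * h s) UNIV S"
  using assms(6)
proof (induction r arbitrary: h)
  case (Suc r)
  have "has_fsum (\<lambda>s. tree_weight (z r) (w r) s * h (cut_old_paths s)) UNIV S"
    using Suc.IH[of "\<lambda>s. h (cut_old_paths s)"] Suc.prems by simp
  from has_fsum_cut[OF assms(1,2,3) this] show ?case by (simp add: assms(4,5))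
qed simp

section \<open>Narayana and Catalan generating functions\<close>

text \<open>
  The lowest nonvanishing coefficient of \<open>D\<close> would survive on the left-hand side, one degree below the
  lowest degree that is possible on the right-hand side.
\<close>

lemma fps_ode_unique:
  fixes D P Q :: "'a::{idom,semiring_char_0} fps"
  assumes ode: "fps_deriv D * P = D * Q" and "P $ 0 = 1" "D $ 0 = 0"
  shows "D = 0"
proof (rule ccontr)
  assume "D \<noteq> 0"
  define k where "k = subdegree D"
  have k: "D $ k \<noteq> 0" "\<And>i. i < k \<Longrightarrow> D $ i = 0"
    using \<open>D \<noteq> 0\<close> by (auto simp: k_def)
  then obtain j where j: "k = Suc j" using assms(3) by (cases k) auto
  have "(fps_deriv D * P) $ j = (\<Sum>i=0..j. fps_deriv D $ i * P $ (j - i))"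
    by (simp only: fps_mult_nth)
  also have "\<dots> = (\<Sum>i\<in>{j}. fps_deriv D $ i * P $ (j - i))"
    by (rule sum.mono_neutral_right) (use k(2) j in auto)
  finally have "(fps_deriv D * P) $ j = of_nat k * D $ k"
    by (simp add: assms(2) j)
  moreover have "(D * Q) $ j = 0"
    unfolding fps_mult_nth by (intro sum.neutral) (use k(2) j in auto)
  ultimately have "of_nat k * D $ k = 0" using ode by simp
  then show False using k(1) j by (simp del: of_nat_Suc)
qed

text \<open>
  The intended case is \<open>f m = narayana_assoc m\<close> evaluated at \<open>x\<close>; for \<open>x = 1\<close> and \<open>m \<ge> 1\<close> these are the
  Catalan numbers.  The quadratic equation for the unscaled series \<open>F\<close> says that
  \<open>R = 1 - (1 + x) * X - 2 * X * F\<close> is the square root of the discriminant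
  \<open>\<Delta> = 1 - 2 * (1 + x) * X + (1 - x)\<^sup>2 * X\<^sup>2\<close>.  The recurrence is the coefficientwise form of
  \<open>2 * \<Delta> * R' = \<Delta>' * R\<close>, so \<open>R\<^sup>2\<close> and \<open>\<Delta>\<close> solve the same first-order equation with
  the same constant term.  The factor \<open>\<tau>\<close> only rescales the variable.
\<close>

lemma narayana_recurrence_gf:
  fixes x \<tau> :: "'a::{idom,semiring_char_0}" and f :: "nat \<Rightarrow> 'a"
  assumes f0: "f 0 = 0" and f1: "f 1 = x"
    and rec: "\<And>m. of_nat (m + 3) * f (m + 2) = of_nat (2 * m + 3) * (1 + x) * f (m + 1) - of_nat m * (1 - x)\<^sup>2 * f m"
  defines "N \<equiv> Abs_fps (\<lambda>m. \<tau> ^ m * f m)"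
  shows "N = fps_const \<tau> * fps_X * (fps_const x + N) * (1 + N)"
proof -
  define F where "F = Abs_fps f"
  define c where "c = fps_const (1 + x)"
  define e where "e = fps_const ((1 - x)\<^sup>2)"
  define R where "R = 1 - c * fps_X - 2 * fps_X * F"
  define \<Delta> where "\<Delta> = 1 - 2 * c * fps_X + e * fps_X\<^sup>2"
  have R0: "R $ 0 = 1" by (simp add: R_def)
  have RS: "R $ Suc n = (if n = 0 then - (1 + x) else 0) - 2 * f n" for n
    by (simp add: R_def F_def c_def mult.assoc)
  have dR: "fps_deriv R * \<Delta> = R * (e * fps_X - c)"
  proof (rule fps_ext)
    fix n
    have lhs: "fps_deriv R * \<Delta> = fps_deriv R - fps_const (2 * (1 + x)) * (fps_X * fps_deriv R) + e * (fps_X ^ 2 * fps_deriv R)"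
      by (simp add: \<Delta>_def c_def algebra_simps flip: fps_const_mult fps_numeral_fps_const)
    have rhs: "R * (e * fps_X - c) = e * (fps_X * R) - c * R" by (simp add: algebra_simps)
    consider "n = 0" | "n = 1" | m where "n = Suc (Suc m)" by (metis One_nat_def not0_implies_Suc)
    then show "(fps_deriv R * \<Delta>) $ n = (R * (e * fps_X - c)) $ n"
    proof cases
      case 1 then show ?thesis unfolding lhs rhs
        by (simp add: e_def c_def R0 RS f0 fps_X_power_mult_nth del: fps_const_mult)
    next
      case 2 then show ?thesis unfolding lhs rhs
        by (simp add: e_def c_def R0 RS f0 f1[simplified] fps_X_power_mult_nth numeral_2_eq_2[symmetric])
           (simp add: RS f1[simplified] eval_nat_numeral R0 f0 algebra_simps)
    next
      case (3 m)
      have "(fps_deriv R * \<Delta>) $ n - (R * (e * fps_X - c)) $ n =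
          - 2 * (of_nat (m + 3) * f (m + 2) - (of_nat (2 * m + 3) * (1 + x) * f (m + 1) - of_nat m * (1 - x)\<^sup>2 * f m))"
        unfolding lhs rhs 3
        by (cases m) (simp_all add: e_def c_def R0 RS f0 fps_X_power_mult_nth algebra_simps power2_eq_square)
      then show ?thesis using rec by simp
    qed
  qed
  have "R\<^sup>2 - \<Delta> = 0"
  proof (rule fps_ode_unique)
    show "fps_deriv (R\<^sup>2 - \<Delta>) * \<Delta> = (R\<^sup>2 - \<Delta>) * (2 * (e * fps_X - c))"
    proof -
      have "fps_deriv \<Delta> = 2 * (e * fps_X - c)"
        by (simp add: \<Delta>_def e_def c_def power2_eq_square algebra_simps)
      moreover have "fps_deriv (R\<^sup>2) * \<Delta> = 2 * R * (fps_deriv R * \<Delta>)"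
        by (simp add: power2_eq_square algebra_simps)
      ultimately have "fps_deriv (R\<^sup>2) * \<Delta> - fps_deriv \<Delta> * \<Delta> = (R\<^sup>2 - \<Delta>) * (2 * (e * fps_X - c))"
        unfolding dR by (simp only:) (simp add: algebra_simps power2_eq_square)
      then show ?thesis by (simp only: fps_deriv_sub left_diff_distrib)
    qed
  qed (simp_all add: \<Delta>_def R0 power2_eq_square)
  moreover have "R\<^sup>2 - \<Delta> = - 4 * fps_X * (F - fps_X * (fps_const x + F) * (1 + F))"
  proof -
    have c: "c = 1 + fps_const x" and e: "e = (1 - fps_const x)\<^sup>2"
      by (simp_all add: c_def e_def flip: fps_const_add fps_const_power fps_const_sub)
    show ?thesis unfolding R_def \<Delta>_def c e by (simp add: algebra_simps power2_eq_square)
  qed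
  ultimately have F: "F = fps_X * (fps_const x + F) * (1 + F)" by simp
  have N: "N = F oo (fps_const \<tau> * fps_X)"
    by (simp add: N_def F_def fps_compose_linear)
  show ?thesis
    by (subst N, subst F)
       (simp add: N fps_compose_mult_distrib fps_compose_add_distrib)
qed

text \<open>
  Reciprocal factorials on all integers, with zeros at the negative ones.  The rule \<open>inv_fact_pred\<close> then
  holds without exception, so identities between binomial products reduce to polynomial identities
  and the boundary cases need no separate treatment.
\<close>

definition inv_fact :: "int \<Rightarrow> real" where
  "inv_fact i = (if i < 0 then 0 else 1 / fact (nat i))"

lemma inv_fact_pred: "inv_fact (i - 1) = of_int i * inv_fact i"
proof (cases "i > 0")
  case True
  then obtain j where "i = int (Suc j)" by (metis Suc_pred' nat_0_le order_less_le zero_less_nat_eq)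
  moreover have "inv_fact (int j) = real (Suc j) * inv_fact (int (Suc j))"
    by (simp add: inv_fact_def nat_add_distrib del: of_nat_Suc)
  ultimately show ?thesis by simp
qed (auto simp: inv_fact_def)

definition narayana_coeff :: "nat \<Rightarrow> int \<Rightarrow> real" where
  "narayana_coeff m k = fact m * fact (m - 1) *
     (inv_fact (k - 1) * inv_fact (int m - k + 1) * inv_fact k * inv_fact (int m - k))"

lemma coeff_narayana_assoc:
  assumes "m \<ge> 1"
  shows "coeff (narayana_assoc m) k = narayana_coeff m (int k)"
proof -
  have "coeff (narayana_assoc m) k = (if k \<in> {1..m} then 1 / real m * real (m choose (k - 1)) * real (m choose k) else 0)"
    unfolding narayana_assoc_def by (simp add: coeff_sum)
  also have "\<dots> = narayana_coeff m (int k)"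
  proof (cases "k \<in> {1..m}")
    case True
    have "real (m choose (k - 1)) = fact m / (fact (k - 1) * fact (m - (k - 1)))"
      by (rule binomial_fact) (use True in auto)
    moreover have "real (m choose k) = fact m / (fact k * fact (m - k))"
      by (rule binomial_fact) (use True in auto)
    moreover have "fact m = real m * fact (m - 1)" using assms by (simp add: fact_reduce)
    moreover have "nat (int m - int k + 1) = m - (k - 1)" "nat (int k - 1) = k - 1" "nat (int m - int k) = m - k"
      using True by auto
    ultimately show ?thesis
      using True assms by (simp add: narayana_coeff_def inv_fact_def mult_ac del: One_nat_def)
  qed (auto simp: narayana_coeff_def inv_fact_def)
  finally show ?thesis .
qed

text \<open>
  All reciprocal factorials that occur are polynomial multiples of \<open>inv_fact k\<close> and
  \<open>inv_fact (m + 4 - k)\<close>; after this reduction the claim is a polynomial identity in \<open>k\<close> and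
  \<open>j = m + 3 - k\<close>.
\<close>

lemma narayana_coeff_rec:
  "real (m + 4) * narayana_coeff (m + 3) k =
     real (2 * m + 5) * (narayana_coeff (m + 2) k + narayana_coeff (m + 2) (k - 1)) -
     real (m + 1) * (narayana_coeff (m + 1) k - 2 * narayana_coeff (m + 1) (k - 1) + narayana_coeff (m + 1) (k - 2))"
proof -
  define j where "j = int m + 3 - k"
  define A B where "A = inv_fact k" and "B = inv_fact (j + 1)"
  define x y where "x = real_of_int k" and "y = real_of_int j"
  have A: "inv_fact (k - 1) = x * A" "inv_fact (k - 2) = (x - 1) * x * A" "inv_fact (k - 3) = (x - 2) * (x - 1) * x * A"
    using inv_fact_pred[of k] inv_fact_pred[of "k - 1"] inv_fact_pred[of "k - 2"] by (simp_all add: A_def x_def)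
  have B: "inv_fact j = (y + 1) * B" "inv_fact (j - 1) = y * (y + 1) * B" "inv_fact (j - 2) = (y - 1) * y * (y + 1) * B"
    using inv_fact_pred[of "j + 1"] inv_fact_pred[of j] inv_fact_pred[of "j - 1"] by (simp_all add: B_def y_def)
  define f where "f = (fact m :: real)"
  have mm: "real m = x + y - 3" by (simp add: x_def y_def j_def)
  have idx: "int (m + 3) - k = j" "int (m + 2) - k = j - 1" "int (m + 1) - k = j - 2"
    "int (m + 2) - (k - 1) = j" "int (m + 1) - (k - 1) = j - 1" "int (m + 1) - (k - 2) = j"
    "k - 1 - 1 = k - 2" "k - 2 - 1 = k - 3" "j - 2 + 1 = j - 1" "j - 1 + 1 = j"
    by (auto simp: j_def)
  have facts: "fact (m + 3) = (real m + 3) * (real m + 2) * (real m + 1) * f" "fact (m + 3 - 1) = (real m + 2) * (real m + 1) * f"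
    "fact (m + 2) = (real m + 2) * (real m + 1) * f" "fact (m + 2 - 1) = (real m + 1) * f" 
    "fact (m + 1) = (real m + 1) * f" "fact (m + 1 - 1) = f"
    by (simp_all add: f_def eval_nat_numeral algebra_simps)
  show ?thesis
    unfolding narayana_coeff_def idx facts A B A_def[symmetric] B_def[symmetric]
    by (simp add: mm) algebra
qed

lemma narayana_assoc_0 [simp]: "narayana_assoc 0 = 0"
  by (simp add: narayana_assoc_def)

lemma narayana_assoc_1: "narayana_assoc 1 = [:0, 1:]"
  by (simp add: narayana_assoc_def monom_altdef)

text \<open>
  The case \<open>m = 0\<close> is separate because the closed form of the coefficients starts at index \<open>1\<close>, while
  \<open>narayana_assoc 0\<close> is an empty sum.
\<close>

lemma narayana_assoc_rec:
  "of_nat (m + 3) * narayana_assoc (m + 2) =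
     of_nat (2 * m + 3) * [:1, 1:] * narayana_assoc (m + 1) - of_nat m * [:1, -1:]\<^sup>2 * narayana_assoc m"
proof (cases m)
  case 0
  have "narayana_assoc 2 = [:0, 1, 1:]"
    by (simp add: narayana_assoc_def eval_nat_numeral monom_altdef)
  then show ?thesis using 0 by (simp add: narayana_assoc_1[simplified] numeral_poly of_nat_poly flip: numeral_2_eq_2)
next
  case (Suc j)
  have sh: "coeff (pCons 0 (narayana_assoc i)) k = narayana_coeff i (int k - 1)" if "i \<ge> 1" for i k
    using coeff_narayana_assoc[OF that]
    by (cases k) (auto simp: narayana_coeff_def inv_fact_def)
  have sh2: "coeff (pCons 0 (pCons 0 (narayana_assoc i))) k = narayana_coeff i (int k - 2)" if "i \<ge> 1" for i k
    using sh[OF that] by (cases k) (auto simp: narayana_coeff_def inv_fact_def)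
  show ?thesis
  proof (rule poly_eqI)
    fix k
    have "coeff (of_nat (m + 3) * narayana_assoc (m + 2)) k = real (j + 4) * narayana_coeff (j + 3) (int k)"
      unfolding of_nat_poly using coeff_narayana_assoc[of "m + 2" k] by (simp add: Suc eval_nat_numeral)
    moreover have "of_nat (2 * m + 3) * [:1, 1:] * narayana_assoc (m + 1) =
        smult (real (2 * j + 5)) (narayana_assoc (j + 2) + pCons 0 (narayana_assoc (j + 2)))"
      unfolding of_nat_poly by (simp add: Suc eval_nat_numeral smult_add_right)
    moreover have "of_nat m * [:1, -1:]\<^sup>2 * narayana_assoc m =
        smult (real (j + 1)) (narayana_assoc (j + 1) - smult 2 (pCons 0 (narayana_assoc (j + 1))) + pCons 0 (pCons 0 (narayana_assoc (j + 1))))"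
    proof -
      have "[:1, -1:]\<^sup>2 = [:1, -2, 1 :: real:]" by (simp add: power2_eq_square)
      moreover have "[:1, -2, 1:] * p = p - smult 2 (pCons 0 p) + pCons 0 (pCons 0 p)" for p :: "real poly"
        by simp
      moreover have "of_nat m * r * narayana_assoc m = smult (real (j + 1)) (r * narayana_assoc (j + 1))" for r
        unfolding of_nat_poly by (simp add: Suc)
      ultimately show ?thesis by (simp only:)
    qed
    ultimately show "coeff (of_nat (m + 3) * narayana_assoc (m + 2)) k =
        coeff (of_nat (2 * m + 3) * [:1, 1:] * narayana_assoc (m + 1) - of_nat m * [:1, -1:]\<^sup>2 * narayana_assoc m) k"
      using narayana_coeff_rec[of j "int k"] coeff_narayana_assoc[of "j + 1" k] coeff_narayana_assoc[of "j + 2" k]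
        sh[of "j + 1" k] sh[of "j + 2" k] sh2[of "j + 1" k]
      by (simp only: coeff_diff coeff_add coeff_smult)
  qed
qed

text \<open>
  Evaluation of a polynomial at \<open>q\<close> is a ring homomorphism into the power series, so it transports the
  recurrence of the Narayana polynomials.
\<close>

lemma narayana_gf:
  fixes q \<tau> :: "real fps"
  assumes q0: "q $ 0 = 0"
  defines "N \<equiv> Abs_fps (\<lambda>m. \<tau> ^ m * (fps_of_poly (narayana_assoc m) oo q))"
  shows "N = fps_const \<tau> * fps_X * (fps_const q + N) * (1 + N)"
  unfolding N_def
proof (rule narayana_recurrence_gf)
  define \<phi> where "\<phi> = (\<lambda>p. fps_of_poly p oo q)"
  have hom: "\<phi> (p + p') = \<phi> p + \<phi> p'" "\<phi> (p - p') = \<phi> p - \<phi> p'" "\<phi> (p * p') = \<phi> p * \<phi> p'" "\<phi> (of_nat n) = of_nat n" for p p' n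
    by (simp_all add: \<phi>_def fps_of_poly_add fps_of_poly_diff fps_of_poly_mult fps_compose_add_distrib
        fps_compose_sub_distrib fps_compose_mult_distrib[OF q0] of_nat_poly fps_of_poly_const fps_of_nat)
  have "\<phi> 1 = 1" "\<phi> [:0, 1:] = q"
    by (simp_all add: \<phi>_def fps_of_poly_pCons q0)
  then have lin: "\<phi> [:1, 1:] = 1 + q" "\<phi> [:1, -1:] = 1 - q"
    using hom(1)[of 1 "[:0, 1:]"] hom(2)[of 1 "[:0, 1:]"] by (simp_all add: one_pCons)
  show "fps_of_poly (narayana_assoc 1) oo q = q"
    unfolding narayana_assoc_1 by (simp add: fps_of_poly_pCons q0)
  fix m
  show "of_nat (m + 3) * (fps_of_poly (narayana_assoc (m + 2)) oo q) =
      of_nat (2 * m + 3) * (1 + q) * (fps_of_poly (narayana_assoc (m + 1)) oo q) -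
      of_nat m * (1 - q)\<^sup>2 * (fps_of_poly (narayana_assoc m) oo q)"
    using arg_cong[OF narayana_assoc_rec[of m], of \<phi>]
    by (simp only: hom lin power2_eq_square) (simp add: \<phi>_def)
qed simp

lemma catalan_rec: "real (m + 2) * catalan (m + 1) = 2 * real (2 * m + 1) * catalan m"
proof -
  have cancel: "x * (2 * x * y * F / (x * f * (x * f))) = 2 * y * (F / (f * f))"
    if "x \<noteq> 0" "f \<noteq> 0" for x y F f :: real
    using that by (simp add: field_simps)
  define b where "b = real (2 * (m + 1) choose (m + 1))"
  define b' where "b' = real (2 * m choose m)"
  have "b = fact (2 * m + 2) / (fact (m + 1) * fact (m + 1))"
    unfolding b_def using binomial_fact[of "m + 1" "2 * (m + 1)"] by simp
  also have "fact (2 * m + 2) = 2 * (real m + 1) * (2 * real m + 1) * fact (2 * m)"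
    by (simp add: algebra_simps)
  also have "fact (m + 1) = (real m + 1) * fact m" by simp
  finally have "(real m + 1) * b = 2 * (2 * real m + 1) * (fact (2 * m) / (fact m * fact m))"
    using cancel[of "real m + 1" "fact m"] by simp
  also have "fact (2 * m) / (fact m * fact m) = b'"
    by (simp add: binomial_fact b'_def)
  finally have "(real m + 1) * b = 2 * (2 * real m + 1) * b'" .
  then have "b = 2 * (2 * real m + 1) * (b' / (real m + 1))"
    by (simp add: field_simps)
  moreover have "real (m + 2) * catalan (m + 1) = b" "catalan m = b' / (real m + 1)"
    by (simp_all add: catalan_def b_def b'_def)
  ultimately show ?thesis by simp
qed

text \<open>
  The Catalan series is \<open>X * (1 + N)\<close> with \<open>N\<close> the Narayana series at \<open>x = 1\<close>, where the second-order
  recurrence loses its last term.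
\<close>

lemma catalan_recurrence_gf:
  fixes \<kappa> :: "'a::{idom,semiring_char_0}" and C :: "nat \<Rightarrow> 'a"
  assumes C0: "C 0 = 1" and rec: "\<And>m. of_nat (m + 2) * C (m + 1) = 2 * of_nat (2 * m + 1) * C m"
  defines "c \<equiv> Abs_fps (\<lambda>d. if d = 0 then 0 else \<kappa> ^ d * C (d - 1))"
  shows "c - c\<^sup>2 = fps_const \<kappa> * fps_X"
proof -
  define N where "N = Abs_fps (\<lambda>m. \<kappa> ^ m * (if m = 0 then 0 else C m))"
  have "2 * C 1 = 2 * 1" using rec[of 0] C0 by simp
  then have C1: "C 1 = 1" by (simp only: mult_cancel_left) simp
  have "N = fps_const \<kappa> * fps_X * (fps_const 1 + N) * (1 + N)"
    unfolding N_def
  proof (rule narayana_recurrence_gf)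
    fix m :: nat
    show "of_nat (m + 3) * (if m + 2 = 0 then 0 else C (m + 2)) =
        of_nat (2 * m + 3) * (1 + 1) * (if m + 1 = 0 then 0 else C (m + 1)) -
        of_nat m * (1 - 1)\<^sup>2 * (if m = 0 then 0 else C m)"
      using rec[of "m + 1"] by (simp add: algebra_simps)
  qed (simp_all add: C1[simplified])
  then have N: "N = fps_const \<kappa> * fps_X * (1 + N)\<^sup>2" by (simp add: power2_eq_square mult.assoc)
  have "c = fps_const \<kappa> * fps_X * (1 + N)"
  proof (rule fps_ext)
    fix n show "c $ n = (fps_const \<kappa> * fps_X * (1 + N)) $ n"
      by (cases n) (auto simp: c_def N_def mult.assoc C0)
  qed
  then have "c - c\<^sup>2 = fps_const \<kappa> * fps_X * (1 + N - fps_const \<kappa> * fps_X * (1 + N)\<^sup>2)"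
    by (simp add: power2_eq_square algebra_simps)
  then show ?thesis unfolding N[symmetric] by simp
qed

section \<open>Iterated cutting in the variable u\<close>

lemma one_plus_X_power_nth: "(1 + fps_X :: 'a::comm_ring_1 fps) ^ k $ d = of_nat (k choose d)"
proof (induction k arbitrary: d)
  case 0
  then show ?case by (cases d) auto
next
  case (Suc k)
  then show ?case by (cases d) (simp_all add: distrib_right)
qed

lemma finite_plane_trees: "finite (plane_trees n)"
  by (rule finite_subset[OF _ finite_trees_of_size_le[of n]]) (auto simp: plane_trees_def nodes_finite_card)

text \<open>
  The coefficients of \<open>(1 + t) ^ k\<close> are binomial coefficients, that is, factorial powers of \<open>k\<close> divided by
  \<open>fact d\<close>.
\<close>

lemma marked_trees_nth:
  fixes S :: "real fps fps"
  assumes "has_fsum (\<lambda>t. tree_weight (fps_const fps_X) (fps_const (fps_X\<^sup>2)) t * (1 + fps_X) ^ stat t) UNIV S"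
  shows "S $ d $ n = (\<Sum>t\<in>plane_trees n. real (stat t choose d))"
proof -
  have weight: "tree_weight (fps_const fps_X) (fps_const (fps_X\<^sup>2)) t = fps_const (fps_X ^ tree_size t :: real fps)" for t
    by (simp add: tree_weight_def tree_size_count power_add power_mult)
  have coeff: "(tree_weight (fps_const fps_X) (fps_const (fps_X\<^sup>2)) t * (1 + fps_X) ^ stat t) $ d $ n =
      (if tree_size t = n then real (stat t choose d) else 0)" for t
    unfolding weight fps_mult_left_const_nth one_plus_X_power_nth
    by (auto simp: fps_X_power_mult_nth fps_of_nat[symmetric])
  have "S $ d $ n = (\<Sum>t\<in>plane_trees n. (tree_weight (fps_const fps_X) (fps_const (fps_X\<^sup>2)) t * (1 + fps_X) ^ stat t) $ d $ n)"
    by (rule has_fsum_coeff[OF assms finite_plane_trees]) (use coeff in \<open>auto simp: plane_trees_def nodes_finite_card\<close>)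
  also have "\<dots> = (\<Sum>t\<in>plane_trees n. real (stat t choose d))"
    by (rule sum.cong) (use coeff in \<open>auto simp: plane_trees_def nodes_finite_card\<close>)
  finally show ?thesis .
qed

lemma u_series_0: "u_series $ 0 = 0" and u_series_eq: "fps_X * (1 + u_series)\<^sup>2 = u_series"
proof -
  have u: "u_series $ 0 = 0 \<and> fps_X = u_series / (1 + u_series)\<^sup>2"
    unfolding u_series_def by (rule theI'[OF ex1_u_series])
  then show "u_series $ 0 = 0" by simp
  then have ne: "(1 + u_series)\<^sup>2 $ 0 \<noteq> 0" by (simp add: power2_eq_square)
  have "fps_X * (1 + u_series)\<^sup>2 = u_series * (inverse ((1 + u_series)\<^sup>2) * (1 + u_series)\<^sup>2)"
    using u ne by (metis fps_divide_unit mult.assoc)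
  then show "fps_X * (1 + u_series)\<^sup>2 = u_series"
    using inverse_mult_eq_1[OF ne] by simp
qed

definition inv_1pu :: "real fps" where "inv_1pu = inverse (1 + u_series)"
definition inv_1mu :: "nat \<Rightarrow> real fps" where "inv_1mu k = inverse (1 - u_series ^ k)"

lemma inv_1pu: "inv_1pu * (1 + u_series) = 1"
  unfolding inv_1pu_def by (rule inverse_mult_eq_1) (simp add: u_series_0)

lemma u_series_power_0: "k > 0 \<Longrightarrow> u_series ^ k $ 0 = 0"
  by (rule startsby_zero_power[OF u_series_0])

lemma inv_1mu: "k > 0 \<Longrightarrow> inv_1mu k * (1 - u_series ^ k) = 1"
  unfolding inv_1mu_def by (rule inverse_mult_eq_1) (simp add: u_series_power_0 u_series_0)

text \<open>
  The iterates of the substitution that describes cutting: \<open>bullet_weight i\<close> and \<open>square_weight i\<close> are the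
  weights of an ordinary node and of an old leaf after \<open>i\<close> steps, and \<open>path_weight i\<close> is the sum over
  the paths attached in the next step, all expressed in \<open>u\<close>.
\<close>

definition bullet_weight :: "nat \<Rightarrow> real fps" where
  "bullet_weight i = (u_series - u_series ^ (i + 2)) * inv_1pu * inv_1mu (i + 2)"

definition square_weight :: "nat \<Rightarrow> real fps" where
  "square_weight i = u_series ^ (i + 2) * (1 - u_series)\<^sup>2 * inv_1pu\<^sup>2 * (inv_1mu (i + 2))\<^sup>2"

definition path_weight :: "nat \<Rightarrow> real fps" where
  "path_weight i = u_series ^ (i + 2) * (1 - u_series)\<^sup>2 * inv_1pu * inv_1mu (i + 2) * inv_1mu (i + 3)"

text \<open>
  One step of the substitution replaces \<open>q = u ^ (i + 2)\<close> by \<open>u * q\<close>; \<open>v\<close>, \<open>p\<close> and \<open>p'\<close> are the reciprocals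
  of the denominators.
\<close>

lemma cut_substitution_identities:
  fixes u v q p p' :: "'a::idom"
  assumes "v * (1 + u) = 1" "p * (1 - q) = 1" "p' * (1 - u * q) = 1"
  shows "q * (1 - u)\<^sup>2 * v\<^sup>2 * p\<^sup>2 = q * (1 - u)\<^sup>2 * v * p * p' * (1 - (u - q) * v * p)"
    and "(u - u * q) * v * p' = (u - q) * v * p + q * (1 - u)\<^sup>2 * v * p * p'"
    and "u * q * (1 - u)\<^sup>2 * v\<^sup>2 * p'\<^sup>2 = q * (1 - u)\<^sup>2 * v * p * p' * ((u - u * q) * v * p')"
  using assms by algebra+

lemma weight_recursion:
  "square_weight i = path_weight i * (1 - bullet_weight i)"
  "bullet_weight (Suc i) = bullet_weight i + path_weight i"
  "square_weight (Suc i) = path_weight i * bullet_weight (Suc i)"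
  using cut_substitution_identities[OF inv_1pu inv_1mu[of "i + 2"], of "inv_1mu (i + 3)"] inv_1mu[of "i + 3"]
  by (simp_all add: square_weight_def path_weight_def bullet_weight_def eval_nat_numeral)

lemma weight_0: "bullet_weight 0 = fps_X" "square_weight 0 = fps_X\<^sup>2"
proof -
  have inv: "inv_1mu 2 * (1 - u_series\<^sup>2) = 1" by (rule inv_1mu) simp
  have "(1 - u_series) * inv_1mu 2 * (inv_1pu * (1 + u_series)) = inv_1pu * (inv_1mu 2 * (1 - u_series\<^sup>2))"
    by (simp add: algebra_simps power2_eq_square)
  then have v: "(1 - u_series) * inv_1mu 2 = inv_1pu" by (simp add: inv inv_1pu)
  have "fps_X * (inv_1pu * (1 + u_series))\<^sup>2 = inv_1pu\<^sup>2 * u_series"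
    by (subst (2) u_series_eq[symmetric]) (simp add: power_mult_distrib mult_ac)
  then have x: "fps_X = inv_1pu\<^sup>2 * u_series" by (simp add: inv_1pu)
  have "bullet_weight 0 = u_series * inv_1pu * ((1 - u_series) * inv_1mu 2)"
    by (simp add: bullet_weight_def algebra_simps power2_eq_square numeral_2_eq_2[symmetric])
  then show "bullet_weight 0 = fps_X" unfolding v x by (simp add: power2_eq_square mult_ac)
  have "square_weight 0 = (u_series * inv_1pu * ((1 - u_series) * inv_1mu 2))\<^sup>2"
    by (simp add: square_weight_def power_mult_distrib numeral_2_eq_2[symmetric] mult_ac)
  then show "square_weight 0 = fps_X\<^sup>2" unfolding v x by (simp add: power2_eq_square mult_ac)
qed

lemma X_dvd_weights: "fps_X dvd bullet_weight i" "fps_X dvd square_weight i"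
proof -
  have u: "fps_X dvd u_series" using u_series_eq by (metis dvd_triv_left)
  then have "fps_X dvd u_series ^ (i + 2)" by (simp add: dvd_power_iff dvd_mult2)
  with u show "fps_X dvd bullet_weight i" "fps_X dvd square_weight i"
    by (simp_all add: bullet_weight_def square_weight_def dvd_mult2)
qed

lemma fps_const_dvd: "a dvd b \<Longrightarrow> fps_const (a::real fps) dvd fps_const b"
  by (auto simp: dvd_def simp flip: fps_const_mult)

text \<open>
  The marks \<open>x\<close> on ordinary nodes and \<open>y\<close> on old leaves of the reduced tree are absorbed into the
  weights, so that the marked sum over all trees is again an instance of the tree generating
  function and satisfies its quadratic equation.
\<close>

lemma marked_reduced_trees:
  fixes x y :: "real fps fps"
  assumes mark: "\<And>s. x ^ ordinary_count s * y ^ old_count s = (1 + fps_X) ^ stat s"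
  obtains L where "L - L\<^sup>2 = fps_const (bullet_weight r) * x + fps_const (square_weight r) * y - (fps_const (bullet_weight r) * x)\<^sup>2"
    and "\<And>d n. L $ d $ n = (\<Sum>t\<in>plane_trees n. real (stat ((cut_old_paths ^^ r) t) choose d))"
proof -
  have dvd: "fps_const fps_X dvd fps_const (bullet_weight i)" "fps_const fps_X dvd fps_const (square_weight i)" for i
    by (simp_all add: fps_const_dvd X_dvd_weights)
  have "locally_finite (\<lambda>t. tree_weight (fps_const (bullet_weight 0)) (fps_const (square_weight 0)) t *
      (1 + fps_X) ^ stat ((cut_old_paths ^^ r) t)) UNIV"
    by (rule locally_finite_tree_weight[OF dvd])
  then obtain L where L: "has_fsum (\<lambda>t. tree_weight (fps_const (bullet_weight 0)) (fps_const (square_weight 0)) t *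
      (1 + fps_X) ^ stat ((cut_old_paths ^^ r) t)) UNIV L"
    by (rule locally_finite_has_fsum)
  have "has_fsum (\<lambda>s. tree_weight (fps_const (bullet_weight r)) (fps_const (square_weight r)) s * (1 + fps_X) ^ stat s) UNIV L"
  proof (rule has_fsum_iterated_cut[where a = "\<lambda>i. fps_const (path_weight i)" and h = "\<lambda>s. (1 + fps_X) ^ stat s"])
    fix i
    show "fps_const fps_X dvd fps_const (bullet_weight i)" "fps_const fps_X dvd fps_const (square_weight i)"
      by (rule dvd)+
    show "fps_const (square_weight i) = fps_const (path_weight i) * (1 - fps_const (bullet_weight i))"
      unfolding weight_recursion(1) by (simp flip: fps_const_1_eq_1)
    show "fps_const (bullet_weight (Suc i)) = fps_const (bullet_weight i) + fps_const (path_weight i)"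
      unfolding weight_recursion(2) by simp
    show "fps_const (square_weight (Suc i)) = fps_const (path_weight i) * fps_const (bullet_weight (Suc i))"
      unfolding weight_recursion(3) by simp
  qed (rule L)
  moreover have "(\<lambda>s. tree_weight (fps_const (bullet_weight r)) (fps_const (square_weight r)) s * (1 + fps_X) ^ stat s) =
      tree_weight (fps_const (bullet_weight r) * x) (fps_const (square_weight r) * y)"
    unfolding mark[symmetric] by (simp add: tree_weight_def power_mult_distrib fun_eq_iff mult_ac)
  ultimately have "has_fsum (tree_weight (fps_const (bullet_weight r) * x) (fps_const (square_weight r) * y)) UNIV L"
    by (simp only:)
  then have "L - L\<^sup>2 = fps_const (bullet_weight r) * x + fps_const (square_weight r) * y - (fps_const (bullet_weight r) * x)\<^sup>2"
    by (rule tree_sum_quadratic[rotated 2]) (intro dvd_mult2 dvd)+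
  moreover have "L $ d $ n = (\<Sum>t\<in>plane_trees n. real (stat ((cut_old_paths ^^ r) t) choose d))" for d n
    by (rule marked_trees_nth) (use L in \<open>simp only: weight_0\<close>)
  ultimately show ?thesis by (rule that)
qed

lemma plane_trees_0: "plane_trees 0 = {}"
proof -
  have "tree_size t \<noteq> 0" for t by (cases t) simp
  then show ?thesis by (simp add: plane_trees_def nodes_finite_card)
qed

section \<open>Factorial moments\<close>

text \<open>
  The other root of \<open>X - X\<^sup>2 = K - K\<^sup>2\<close> is \<open>1 - K\<close>.
\<close>

lemma quadratic_root_unique:
  fixes K L :: "'a::idom"
  assumes "K - K\<^sup>2 = L - L\<^sup>2" "K + L \<noteq> 1"
  shows "K = L"
proof -
  have "(K - L) * (1 - (K + L)) = (K - K\<^sup>2) - (L - L\<^sup>2)"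
    by (simp add: algebra_simps power2_eq_square)
  then have "(K - L) * (1 - (K + L)) = 0" using assms(1) by simp
  then show ?thesis using assms(2) by simp
qed

text \<open>
  The generating function \<open>L(z\<^sub>r, w\<^sub>r)\<close> minus \<open>z\<^sub>r\<close>; it is the root \<open>M\<close> with vanishing constant term of
  \<open>M * (1 - 2 * z\<^sub>r) - M\<^sup>2 = w\<^sub>r\<close>.
\<close>

definition small_root :: "nat \<Rightarrow> real fps" where
  "small_root r = (1 - u_series) * inv_1pu * u_series ^ (r + 2) * inv_1mu (r + 2)"

text \<open>
  The discriminant \<open>(1 - 2 * z)\<^sup>2 - 4 * w\<close> is the square of \<open>\<beta> = (1 - u) * v\<close>.  Writing the root for the
  marked weight \<open>w * (1 + T)\<close> as its value at \<open>T = 0\<close> plus \<open>\<beta> * c\<close> therefore leaves the equation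
  \<open>c - c\<^sup>2 = w * T / \<beta>\<^sup>2\<close>, and \<open>w / \<beta>\<^sup>2 = q * p\<^sup>2\<close>.
\<close>

lemma square_quadratic:
  fixes u v q p c T :: "'a::idom"
  assumes "v * (1 + u) = 1" "p * (1 - q) = 1" "c - c\<^sup>2 = q * p\<^sup>2 * T"
  defines "z \<equiv> (u - q) * v * p" and "w \<equiv> q * (1 - u)\<^sup>2 * v\<^sup>2 * p\<^sup>2"
    and "K \<equiv> (u - q) * v * p + (1 - u) * v * q * p + (1 - u) * v * c"
  shows "K - K\<^sup>2 = z + w * (1 + T) - z\<^sup>2"
  unfolding z_def w_def K_def using assms(1-3) by algebra

text \<open>
  Writing the root for the marked weight \<open>z * (1 + T)\<close> as \<open>z * (1 + T)\<close> plus the small root at \<open>T = 0\<close> plus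
  \<open>\<beta> * e\<close> with \<open>\<beta> = (1 - u) * v\<close> leaves \<open>e = s * q + s * (1 - q) * e + e\<^sup>2\<close> with
  \<open>s = 2 * z * p * T / \<beta>\<close>.  The substitution \<open>e = s * (q + N)\<close> turns this into the equation
  of the Narayana series; \<open>s\<close> is written without division as \<open>2 * (u - q) * b * p\<^sup>2 * T\<close>.
\<close>

lemma bullet_quadratic:
  fixes u v q p b N T :: "'a::idom"
  assumes "v * (1 + u) = 1" "p * (1 - q) = 1" "b * (1 - u) = 1"
    and "N = 2 * (u - q) * b * p\<^sup>2 * T * (q + N) * (1 + N)"
  defines "z \<equiv> (u - q) * v * p" and "w \<equiv> q * (1 - u)\<^sup>2 * v\<^sup>2 * p\<^sup>2"
    and "K \<equiv> (u - q) * v * p * (1 + T) + (1 - u) * v * q * p + (1 - u) * v * (2 * (u - q) * b * p\<^sup>2 * T * (q + N))"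
  shows "K - K\<^sup>2 = z * (1 + T) + w - (z * (1 + T))\<^sup>2"
  unfolding z_def w_def K_def using assms(1-4) by algebra


lemma one_minus_fps_const: "1 - fps_const a = fps_const (1 - a :: 'a::comm_ring_1)"
  and one_plus_fps_const: "1 + fps_const a = fps_const (1 + a :: 'a::comm_ring_1)"
  by (simp_all flip: fps_const_1_eq_1)

lemma fps_const_units:
  fixes u v p q :: "real fps"
  assumes "v * (1 + u) = 1" "p * (1 - q) = 1"
  shows "fps_const v * (1 + fps_const u) = 1" "fps_const p * (1 - fps_const q) = 1"
  using assms by (simp_all add: one_minus_fps_const one_plus_fps_const)

lemma small_root_nth_0: "small_root r $ 0 = 0"
  by (simp add: small_root_def u_series_power_0 u_series_0)

lemma X_dvd_nth_0: "fps_X dvd (f :: real fps) \<Longrightarrow> f $ 0 = 0"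
  by (auto simp: dvd_def)

lemma square_moment_series:
  shows "(\<Sum>t\<in>plane_trees n. real (old_count ((cut_old_paths ^^ r) t) choose d)) =
    (if d = 0 then bullet_weight r + small_root r
     else (1 - u_series) * inv_1pu * ((u_series ^ (r + 2) * (inv_1mu (r + 2))\<^sup>2) ^ d * fps_const (catalan (d - 1)))) $ n"
proof -
  define \<kappa> where "\<kappa> = u_series ^ (r + 2) * (inv_1mu (r + 2))\<^sup>2"
  define \<beta> where "\<beta> = (1 - u_series) * inv_1pu"
  define c where "c = Abs_fps (\<lambda>d. if d = 0 then 0 else \<kappa> ^ d * fps_const (catalan (d - 1)))"
  have c: "c - c\<^sup>2 = fps_const \<kappa> * fps_X"
    unfolding c_def
  proof (rule catalan_recurrence_gf)
    fix m
    have "fps_const (real (m + 2) * catalan (m + 1)) = fps_const (2 * real (2 * m + 1) * catalan m)"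
      by (simp only: catalan_rec)
    then show "of_nat (m + 2) * fps_const (catalan (m + 1)) = 2 * of_nat (2 * m + 1) * fps_const (catalan m)"
      by (simp only: fps_of_nat[symmetric] fps_numeral_fps_const fps_const_mult)
  qed (simp add: catalan_def)
  define K where "K = fps_const (bullet_weight r) + fps_const (small_root r) + fps_const \<beta> * c"
  obtain L where L: "L - L\<^sup>2 = fps_const (bullet_weight r) * 1 + fps_const (square_weight r) * (1 + fps_X) - (fps_const (bullet_weight r) * 1)\<^sup>2"
    and Ln: "\<And>d n. L $ d $ n = (\<Sum>t\<in>plane_trees n. real (old_count ((cut_old_paths ^^ r) t) choose d))"
    by (rule marked_reduced_trees[of 1 "1 + fps_X" old_count r]) simp_all
  have inv: "inv_1mu (r + 2) * (1 - u_series ^ (r + 2)) = 1" by (rule inv_1mu) simp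
  have c': "c - c\<^sup>2 = fps_const (u_series ^ (r + 2)) * (fps_const (inv_1mu (r + 2)))\<^sup>2 * fps_X"
    using c by (simp add: \<kappa>_def)
  have "K - K\<^sup>2 = L - L\<^sup>2"
    using square_quadratic[OF fps_const_units[OF inv_1pu inv] c'] L
    by (simp add: K_def \<beta>_def bullet_weight_def square_weight_def small_root_def one_minus_fps_const)
  moreover have "K + L \<noteq> 1"
  proof
    assume "K + L = 1"
    then have "(K + L) $ 0 $ 0 = 1" by simp
    moreover have "K $ 0 $ 0 = 0"
      by (simp add: K_def c_def small_root_nth_0 X_dvd_nth_0[OF X_dvd_weights(1)])
    moreover have "L $ 0 $ 0 = 0" unfolding Ln plane_trees_0 by simp
    ultimately show False by simp
  qed
  ultimately have "K = L" by (rule quadratic_root_unique)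
  then show ?thesis
    unfolding Ln[symmetric] by (auto simp: K_def c_def \<beta>_def \<kappa>_def)
qed

text \<open>
  The zeroth moment counts all trees.  It is read off from the same series as the other moments: at
  \<open>r = 0\<close> this series and the Catalan series solve the same quadratic equation.
\<close>

lemma card_plane_trees:
  assumes "n \<ge> 1"
  shows "real (card (plane_trees n)) = catalan (n - 1)"
proof -
  define c where "c = Abs_fps (\<lambda>d. if d = 0 then 0 else 1 ^ d * catalan (d - 1))"
  have c: "c - c\<^sup>2 = fps_const 1 * fps_X"
    unfolding c_def by (rule catalan_recurrence_gf) (use catalan_rec in \<open>simp_all add: catalan_def\<close>)
  define T where "T = bullet_weight 0 + small_root 0"
  have "inv_1mu 2 * (1 - u_series\<^sup>2) = 1" by (rule inv_1mu) simp
  \<comment> \<open>The unmarked case: the marking variable and the correction term are both zero.\<close>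
  from square_quadratic[OF inv_1pu this, of 0 0] have "T - T\<^sup>2 = bullet_weight 0 + square_weight 0 - (bullet_weight 0)\<^sup>2"
    by (simp add: T_def small_root_def bullet_weight_def square_weight_def numeral_2_eq_2[symmetric])
  then have "T - T\<^sup>2 = fps_X" by (simp add: weight_0)
  moreover have "T + c \<noteq> 1"
  proof
    assume "T + c = 1"
    then have "(T + c) $ 0 = 1" by simp
    then show False by (simp add: T_def c_def weight_0 small_root_nth_0)
  qed
  ultimately have "T = c" using quadratic_root_unique[of T c] c by simp
  have "real (card (plane_trees n)) = (\<Sum>t\<in>plane_trees n. real (old_count ((cut_old_paths ^^ 0) t) choose 0))"
    by simp
  also have "\<dots> = T $ n"
    unfolding square_moment_series by (simp add: T_def)
  also have "\<dots> = catalan (n - 1)" using assms by (simp add: \<open>T = c\<close> c_def)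
  finally show ?thesis .
qed

text \<open>
  The terms for \<open>j = 0\<close> come from the parts \<open>z * (1 + T)\<close> and \<open>s * q\<close> of the root; they are the
  reason why the mean has a formula of its own.
\<close>

lemma bullet_moment_series:
  fixes r :: nat
  defines "q \<equiv> u_series ^ (r + 2)" and "\<tau> \<equiv> 2 * (u_series - u_series ^ (r + 2)) * inv_1mu 1 * (inv_1mu (r + 2))\<^sup>2"
  shows "(\<Sum>t\<in>plane_trees n. real (ordinary_count ((cut_old_paths ^^ r) t) choose Suc j)) =
    ((if j = 0 then bullet_weight r else 0) + (1 - u_series) * inv_1pu * (\<tau> *
       ((if j = 0 then q else 0) + \<tau> ^ j * (fps_of_poly (narayana_assoc j) oo q)))) $ n"
proof -
  define \<beta> where "\<beta> = (1 - u_series) * inv_1pu"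
  define N where "N = Abs_fps (\<lambda>m. \<tau> ^ m * (fps_of_poly (narayana_assoc m) oo q))"
  have q0: "q $ 0 = 0" unfolding q_def by (rule u_series_power_0) simp
  have N: "N = fps_const \<tau> * fps_X * (fps_const q + N) * (1 + N)"
    unfolding N_def by (rule narayana_gf[OF q0])
  define K where "K = fps_const (bullet_weight r) * (1 + fps_X) + fps_const (small_root r) +
      fps_const \<beta> * (fps_const \<tau> * fps_X * (fps_const q + N))"
  obtain L where L: "L - L\<^sup>2 = fps_const (bullet_weight r) * (1 + fps_X) + fps_const (square_weight r) * 1 - (fps_const (bullet_weight r) * (1 + fps_X))\<^sup>2"
    and Ln: "\<And>d n. L $ d $ n = (\<Sum>t\<in>plane_trees n. real (ordinary_count ((cut_old_paths ^^ r) t) choose d))"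
    by (rule marked_reduced_trees[of "1 + fps_X" 1 ordinary_count r]) simp_all
  have inv: "inv_1mu (r + 2) * (1 - q) = 1" unfolding q_def by (rule inv_1mu) simp
  have inv1: "inv_1mu 1 * (1 - u_series) = 1" using inv_1mu[of 1] by simp
  have \<tau>: "fps_const \<tau> = 2 * (fps_const u_series - fps_const q) * fps_const (inv_1mu 1) * (fps_const (inv_1mu (r + 2)))\<^sup>2"
    by (simp add: \<tau>_def q_def fps_numeral_fps_const)
  have "K - K\<^sup>2 = L - L\<^sup>2"
    using bullet_quadratic[OF fps_const_units[OF inv_1pu inv] fps_const_units(2)[OF inv_1pu inv1] N[unfolded \<tau>]] L
    unfolding K_def \<tau>
    by (simp add: \<beta>_def bullet_weight_def square_weight_def small_root_def q_def one_minus_fps_const)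
  moreover have "K + L \<noteq> 1"
  proof
    assume "K + L = 1"
    then have "(K + L) $ 0 $ 0 = 1" by simp
    moreover have "K $ 0 $ 0 = 0"
      by (simp add: K_def small_root_nth_0 X_dvd_nth_0[OF X_dvd_weights(1)] mult.assoc)
    moreover have "L $ 0 $ 0 = 0" unfolding Ln plane_trees_0 by simp
    ultimately show False by simp
  qed
  ultimately have "K = L" by (rule quadratic_root_unique)
  then show ?thesis
    unfolding Ln[symmetric] by (auto simp: K_def N_def \<beta>_def mult.assoc distrib_left)
qed

lemma uniform_expectation_sum:
  assumes "n \<ge> 1"
  shows "uniform_expectation n f = (\<Sum>t\<in>plane_trees n. f t) / catalan (n - 1)"
proof -
  have "catalan (n - 1) > 0" by (simp add: catalan_def)
  then have "plane_trees n \<noteq> {}" using card_plane_trees[OF assms] by auto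
  then show ?thesis
    unfolding uniform_expectation_def card_plane_trees[OF assms, symmetric]
    by (simp add: integral_pmf_of_set finite_plane_trees)
qed

lemma falling_fact_nat: "falling_fact (real k) d = fact d * real (k choose d)"
  by (simp add: falling_fact_def binomial_gbinomial gbinomial_prod_rev atLeast0LessThan)

lemma X_square_count: "X_square r t = old_count ((cut_old_paths ^^ r) t)"
  by (simp add: X_square_def card_old_leaves)

lemma X_bullet_count: "X_bullet r t = ordinary_count ((cut_old_paths ^^ r) t)"
  by (simp add: X_bullet_def Let_def card_bullets)

lemma fact_fps: "fact d = (fps_const (fact d) :: real fps)"
  by (metis fps_of_nat of_nat_fact)

lemma inv_1mu_power: "inverse ((1 - u_series ^ k) ^ m) = inv_1mu k ^ m"
  by (simp add: inv_1mu_def fps_inverse_power)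

theorem proposition5p6:
  fixes r n d :: nat and u :: "real fps"
  assumes "n \<ge> 1" and "d \<ge> 1"
  defines "u \<equiv> u_series"
  shows "uniform_expectation n (\<lambda>t. falling_fact (real (X_square r t)) d) =
           falling_fact (2 * real d - 2) (d - 1) / catalan (n - 1) *
           fps_nth ((1 - u) / (1 + u) * (u ^ (r * d + 2 * d) / (1 - u ^ (r + 2)) ^ (2 * d))) n
       \<and> uniform_expectation n (\<lambda>t. real (X_bullet r t)) =
           1 / catalan (n - 1) *
           fps_nth (u * (1 - u ^ (r + 1)) * (1 + u ^ (r + 2)) /
                    ((1 + u) * (1 - u ^ (r + 2))\<^sup>2)) n
       \<and> (d > 1 \<longrightarrow>
          uniform_expectation n (\<lambda>t. falling_fact (real (X_bullet r t)) d) =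
            1 / catalan (n - 1) *
            fps_nth ((1 - u ^ (r + 1)) ^ d * u ^ d * 2 ^ d * fact d /
                     ((1 - u) ^ (d - 1) * (1 + u) * (1 - u ^ (r + 2)) ^ (2 * d)) *
                     (fps_of_poly (narayana_assoc (d - 1)) oo u ^ (r + 2))) n)"
proof -
  define q p v where "q = u ^ (r + 2)" and "p = inv_1mu (r + 2)" and "v = inv_1pu"
  have q0: "q $ 0 = 0" unfolding q_def u_def by (rule u_series_power_0) simp
  have u0: "u $ 0 = 0" unfolding u_def by (rule u_series_0)
  have v: "inverse (1 + u) = v" by (simp add: v_def inv_1pu_def u_def)
  have p: "inverse ((1 - q) ^ m) = p ^ m" for m
    unfolding q_def p_def u_def by (rule inv_1mu_power)
  have p1: "inverse (1 - q) = p" using p[of 1] by simp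
  have b: "inverse ((1 - u) ^ m) = inv_1mu 1 ^ m" for m
    using inv_1mu_power[of 1 m] by (simp add: u_def)
  have b1: "inv_1mu 1 * (1 - u) = 1" using inv_1mu[of 1] by (simp add: u_def)
  have pq: "p * (1 - q) = 1" unfolding p_def q_def u_def by (rule inv_1mu) simp
  note E = uniform_expectation_sum[OF assms(1)]
  have square: "uniform_expectation n (\<lambda>t. falling_fact (real (X_square r t)) d) =
           falling_fact (2 * real d - 2) (d - 1) / catalan (n - 1) *
           fps_nth ((1 - u) / (1 + u) * (u ^ (r * d + 2 * d) / (1 - u ^ (r + 2)) ^ (2 * d))) n"
  proof -
    have rhs: "(1 - u) / (1 + u) * (u ^ (r * d + 2 * d) / (1 - u ^ (r + 2)) ^ (2 * d)) =
        (1 - u) * v * (q * p\<^sup>2) ^ d"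
    proof -
      have "u ^ (r * d + 2 * d) = q ^ d"
        unfolding q_def power_mult[symmetric] by (simp only: add_mult_distrib)
      then show ?thesis
        unfolding q_def[symmetric]
        by (simp add: fps_divide_unit u0 q0 v p power_mult_distrib power_mult[symmetric] mult_ac)
    qed
    have const: "fact d * catalan (d - 1) = falling_fact (2 * real d - 2) (d - 1)"
    proof -
      obtain e where e: "d = Suc e" using assms(2) by (cases d) auto
      then show ?thesis
        using falling_fact_nat[of "2 * e" e] by (simp add: catalan_def field_simps)
    qed
    have "(\<Sum>t\<in>plane_trees n. falling_fact (real (X_square r t)) d) =
        fact d * (\<Sum>t\<in>plane_trees n. real (old_count ((cut_old_paths ^^ r) t) choose d))"
      by (simp add: falling_fact_nat X_square_count sum_distrib_left)
    also have "\<dots> = fact d * (((1 - u) * v * (q * p\<^sup>2) ^ d) * fps_const (catalan (d - 1))) $ n"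
      using assms(2) unfolding square_moment_series by (simp add: u_def v_def q_def p_def mult.assoc)
    also have "\<dots> = fact d * catalan (d - 1) * ((1 - u) * v * (q * p\<^sup>2) ^ d) $ n"
      by (simp only: fps_mult_right_const_nth) (simp only: mult_ac)
    finally show ?thesis unfolding E rhs const[symmetric] by simp
  qed
  have bullet: "(\<Sum>t\<in>plane_trees n. falling_fact (real (X_bullet r t)) (Suc j)) =
      fact (Suc j) * ((if j = 0 then (u - q) * v * p else 0) + (1 - u) * v * (2 * (u - q) * inv_1mu 1 * p\<^sup>2 *
       ((if j = 0 then q else 0) + (2 * (u - q) * inv_1mu 1 * p\<^sup>2) ^ j * (fps_of_poly (narayana_assoc j) oo q)))) $ n" for j
    using bullet_moment_series[where r = r and n = n and j = j]
    by (simp only: falling_fact_nat X_bullet_count sum_distrib_left[symmetric] bullet_weight_def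
        q_def p_def v_def u_def)
  have uq: "u - q = u * (1 - u ^ (r + 1))" by (simp add: q_def algebra_simps)
  have mean: "uniform_expectation n (\<lambda>t. real (X_bullet r t)) =
           1 / catalan (n - 1) *
           fps_nth (u * (1 - u ^ (r + 1)) * (1 + u ^ (r + 2)) /
                    ((1 + u) * (1 - u ^ (r + 2))\<^sup>2)) n"
  proof -
    have "u * (1 - u ^ (r + 1)) * (1 + u ^ (r + 2)) / ((1 + u) * (1 - u ^ (r + 2))\<^sup>2) =
        (u - q) * (1 + q) * (v * p\<^sup>2)"
      unfolding q_def[symmetric] uq
      by (subst fps_divide_unit) (simp_all add: u0 q0 v p1 fps_inverse_mult power2_eq_square)
    also have "\<dots> = (u - q) * v * p + (1 - u) * v * (2 * (u - q) * inv_1mu 1 * p\<^sup>2 * q)"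
      using b1 pq by algebra
    finally have "(\<Sum>t\<in>plane_trees n. falling_fact (real (X_bullet r t)) (Suc 0)) =
        fps_nth (u * (1 - u ^ (r + 1)) * (1 + u ^ (r + 2)) / ((1 + u) * (1 - u ^ (r + 2))\<^sup>2)) n"
      unfolding bullet by simp
    then show ?thesis unfolding E by (simp add: falling_fact_def)
  qed
  have higher: "uniform_expectation n (\<lambda>t. falling_fact (real (X_bullet r t)) d) =
            1 / catalan (n - 1) *
            fps_nth ((1 - u ^ (r + 1)) ^ d * u ^ d * 2 ^ d * fact d /
                     ((1 - u) ^ (d - 1) * (1 + u) * (1 - u ^ (r + 2)) ^ (2 * d)) *
                     (fps_of_poly (narayana_assoc (d - 1)) oo u ^ (r + 2))) n" if "d > 1"
  proof -
    obtain j where j: "d = Suc j" "j > 0" using \<open>d > 1\<close> by (cases d) auto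
    define s where "s = fps_of_poly (narayana_assoc j) oo q"
    have "(1 - u ^ (r + 1)) ^ d * u ^ d * 2 ^ d * fact d /
        ((1 - u) ^ (d - 1) * (1 + u) * (1 - u ^ (r + 2)) ^ (2 * d)) =
        (u - q) ^ d * 2 ^ d * fact d * (inv_1mu 1 ^ j * v * (p\<^sup>2) ^ d)"
    proof -
      have "((1 - u) ^ j * (1 + u) * (1 - q) ^ (2 * d)) $ 0 \<noteq> 0"
        by (simp add: u0 q0)
      moreover have "inverse ((1 - u) ^ j * (1 + u) * (1 - q) ^ (2 * d)) = inv_1mu 1 ^ j * v * (p\<^sup>2) ^ d"
        by (simp only: fps_inverse_mult v b p) (simp only: power_mult)
      moreover have "(1 - u ^ (r + 1)) ^ d * u ^ d = (u - q) ^ d"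
        unfolding uq by (simp only: power_mult_distrib mult.commute)
      ultimately show ?thesis
        unfolding q_def[symmetric] using j by (simp only: fps_divide_unit diff_Suc_1 not_False_eq_True)
    qed
    also have "\<dots> = fact d * ((1 - u) * v * (2 * (u - q) * inv_1mu 1 * p\<^sup>2) * (2 * (u - q) * inv_1mu 1 * p\<^sup>2) ^ j)"
    proof -
      have collect: "(1 - u) * v * (2 * y * b * p2) * (2 * y * b * p2) ^ j = y ^ Suc j * 2 ^ Suc j * (b ^ j * v * p2 ^ Suc j)"
        if "b * (1 - u) = 1" for y b p2 :: "real fps"
      proof -
        have "(1 - u) * v * (2 * y * b * p2) * (2 * y * b * p2) ^ j = (b * (1 - u)) * v * (2 * y * p2) * (2 * y * b * p2) ^ j"
          by (simp only: mult_ac)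
        then show ?thesis unfolding that by (simp add: power_mult_distrib mult_ac)
      qed
      show ?thesis unfolding j collect[OF b1] by (simp only: mult_ac)
    qed
    finally have "(1 - u ^ (r + 1)) ^ d * u ^ d * 2 ^ d * fact d /
        ((1 - u) ^ (d - 1) * (1 + u) * (1 - u ^ (r + 2)) ^ (2 * d)) *
        (fps_of_poly (narayana_assoc (d - 1)) oo u ^ (r + 2)) =
        fps_const (fact d) * ((1 - u) * v * (2 * (u - q) * inv_1mu 1 * p\<^sup>2 * ((2 * (u - q) * inv_1mu 1 * p\<^sup>2) ^ j * s)))"
      unfolding s_def by (simp add: j q_def fact_fps mult.assoc)
    then show ?thesis
      unfolding E using bullet[of j] j by (simp add: s_def)
  qed
  show ?thesis using square mean higher by blast
qed

end
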